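(* Let $(G_n)_{n\in\omega}$ be a tower of topological groups satisfying $\mathrm{PTA}$, and let $G=\bigcup_{n\in\omega}G_n$. Then the semitopological group $\overrightarrow{G}=(G,\overrightarrow{\tau})$ is a topological group, and hence all of the following hold, where $\overleftarrow{G}=(G,\overleftarrow{\tau})$, $\overset{\rightleftharpoons}{G}=(G,\overset{\rightleftharpoons}{\tau})$, $\overleftrightarrow{G}=(G,\overleftrightarrow{\tau})$: $\overleftarrow{G}$, $\overset{\rightleftharpoons}{G}$ and $\overleftrightarrow{G}$ are topological groups; the identity map $\overleftrightarrow{G}\to\overset{\rightleftharpoons}{G}$ is continuous; and the identity maps $\overset{\rightleftharpoons}{G}\to\mathrm{g}\text{-}\varinjlim G_n$ and $\overleftrightarrow{G}\to\mathrm{g}\text{-}\varinjlim G_n$ are homeomorphisms. In particular, the topology of $\mathrm{g}\text{-}\varinjlim G_n$ coincides with each of the topologies $\overrightarrow{\tau}$, $\overleftarrow{\tau}$, $\overset{\rightleftharpoons}{\tau}$, $\overleftrightarrow{\tau}$.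
   Context: $\omega=\{0,1,2,\dots\}$. Topological groups are not assumed Hausdorff. A tower of topological groups is a sequence $G_0\subset G_1\subset G_2\subset\cdots$ of topological groups in which each $G_n$ is a topological subgroup of $G_{n+1}$ (a subgroup carrying the subspace topology); $G=\bigcup_{n\in\omega}G_n$ is its union, a group with neutral element $e$. PTA (Passing Through Assumption): a tower $(G_n)_{n\in\omega}$ satisfies $\mathrm{PTA}$ if each group $G_n$ has a neighborhood base at $e$ consisting of open symmetric neighborhoods $U=U^{-1}\subset G_n$ such that for every $m\ge n$ and every neighborhood $V\subset G_m$ of $e$ there is a neighborhood $W\subset G_m$ of $e$ with $WU\subset UV$. $\mathrm{g}\text{-}\varinjlim G_n$ is the group $G$ endowed with the strongest (not necessarily Hausdorff) topology that turns $G$ into a topological group and makes all the inclusions $G_n\to G$, $n\in\omega$, continuous. For each $n$ fix a neighborhood base $\mathcal B_n$ at $e$ in $G_n$ consisting of open symmetric neighborhoods $U=U^{-1}\subset G_n$ of $e$ (the topologies below do not depend on this choice). For a sequence $(U_n)_{n\in\omega}$ of subsets of $G$ put $$\overrightarrow{\prod}_{n\in\omega}U_n=\bigcup_{m\in\omega}U_0U_1\cdots U_m,\qquad \overleftarrow{\prod}_{n\in\omega}U_n=\bigcup_{m\in\omega}U_m\cdots U_1U_0,\qquad \overleftrightarrow{\prod}_{n\in\omega}U_n=\bigcup_{m\in\omega}U_m\cdots U_1U_0\,U_0U_1\cdots U_m .$$ Four topologies on $G$ are defined by the following bases, where $x,y$ range over $G$ and $(U_n)_{n\in\omega}$ over $\prod_{n\in\omega}\mathcal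 B_n$: - $\overrightarrow{\tau}$: the sets $\big(\overrightarrow{\prod}_{n\in\omega}U_n\big)\cdot x$; - $\overleftarrow{\tau}$: the sets $x\cdot\big(\overleftarrow{\prod}_{n\in\omega}U_n\big)$; - $\overleftrightarrow{\tau}$: the sets $x\cdot\big(\overleftrightarrow{\prod}_{n\in\omega}U_n\big)\cdot y$; - $\overset{\rightleftharpoons}{\tau}$: the sets $x\big(\overleftarrow{\prod}_{n\in\omega}U_n\big)\cap\big(\overrightarrow{\prod}_{n\in\omega}U_n\big)y$. With each of these topologies $G$ is a semitopological group (left and right translations are continuous); neighborhood bases at $e$ are given respectively by the sets $\overrightarrow{\prod}_{n}U_n$, $\overleftarrow{\prod}_{n}U_n$, $\overleftrightarrow{\prod}_{n}U_n$ and $\big(\overrightarrow{\prod}_{n}U_n\big)\cap\big(\overleftarrow{\prod}_{n}U_n\big)$, with $(U_n)\in\prod_n\mathcal B_n$. *)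

theory Defs
  imports "HOL-Analysis.Analysis" "HOL-Algebra.Coset"
begin

section \<open>Topological groups and towers\<close>

definition topological_group :: "('a, 'b) monoid_scheme \<Rightarrow> 'a topology \<Rightarrow> bool" where
  "topological_group G X \<longleftrightarrow>
     group G \<and> topspace X = carrier G \<and>
     continuous_map (prod_topology X X) X (\<lambda>(x, y). x \<otimes>\<^bsub>G\<^esub> y) \<and>
     continuous_map X X (\<lambda>x. inv\<^bsub>G\<^esub> x)"

text \<open>
  The groups \<open>H n\<close> of a tower are presented as subgroups of their union \<open>G\<close>, so the group operations
  of each \<open>H n\<close>, and the neutral element, are those of \<open>G\<close>; \<open>T n\<close> is the topology of \<open>H n\<close>.
\<close>

definition group_tower ::
    "('a, 'b) monoid_scheme \<Rightarrow> (nat \<Rightarrow> 'a set) \<Rightarrow> (nat \<Rightarrow> 'a topology) \<Rightarrow> bool" where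
  "group_tower G H T \<longleftrightarrow>
     group G \<and> carrier G = (\<Union>n. H n) \<and>
     (\<forall>n. subgroup (H n) G \<and>
          topological_group (G\<lparr>carrier := H n\<rparr>) (T n) \<and>
          H n \<subseteq> H (Suc n) \<and>
          T n = subtopology (T (Suc n)) (H n))"

text \<open>Neighborhoods need not be open.\<close>

definition neighborhood :: "'a topology \<Rightarrow> 'a \<Rightarrow> 'a set \<Rightarrow> bool" where
  "neighborhood X x V \<longleftrightarrow> V \<subseteq> topspace X \<and> (\<exists>O'. openin X O' \<and> x \<in> O' \<and> O' \<subseteq> V)"

definition symmetric_base_at_one ::
    "('a, 'b) monoid_scheme \<Rightarrow> 'a topology \<Rightarrow> 'a set set \<Rightarrow> bool" where
  "symmetric_base_at_one G X B \<longleftrightarrow>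
     (\<forall>U\<in>B. openin X U \<and> \<one>\<^bsub>G\<^esub> \<in> U \<and> set_inv\<^bsub>G\<^esub> U = U) \<and>
     neighbourhood_base_at \<one>\<^bsub>G\<^esub> (\<lambda>U. U \<in> B) X"

definition PTA :: "('a, 'b) monoid_scheme \<Rightarrow> (nat \<Rightarrow> 'a topology) \<Rightarrow> bool" where
  "PTA G T \<longleftrightarrow>
     (\<forall>n. \<exists>B. symmetric_base_at_one G (T n) B \<and>
        (\<forall>U\<in>B. \<forall>m\<ge>n. \<forall>V. neighborhood (T m) \<one>\<^bsub>G\<^esub> V \<longrightarrow>
           (\<exists>W. neighborhood (T m) \<one>\<^bsub>G\<^esub> W \<and> W <#>\<^bsub>G\<^esub> U \<subseteq> U <#>\<^bsub>G\<^esub> V)))"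


section \<open>The direct limit in the category of topological groups\<close>

definition admissible_group_topology ::
    "('a, 'b) monoid_scheme \<Rightarrow> (nat \<Rightarrow> 'a topology) \<Rightarrow> 'a topology \<Rightarrow> bool" where
  "admissible_group_topology G T X \<longleftrightarrow>
     topological_group G X \<and> (\<forall>n. continuous_map (T n) X (\<lambda>x. x))"

definition strongest_admissible ::
    "('a, 'b) monoid_scheme \<Rightarrow> (nat \<Rightarrow> 'a topology) \<Rightarrow> 'a topology \<Rightarrow> bool" where
  "strongest_admissible G T X \<longleftrightarrow>
     admissible_group_topology G T X \<and>
     (\<forall>Y. admissible_group_topology G T Y \<longrightarrow> (\<forall>U. openin Y U \<longrightarrow> openin X U))"

definition g_lim :: "('a, 'b) monoid_scheme \<Rightarrow> (nat \<Rightarrow> 'a topology) \<Rightarrow> 'a topology" where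
  "g_lim G T = (THE X. strongest_admissible G T X)"

lemma admissible_indiscrete:
  assumes "group G" "\<And>n. topspace (T n) \<subseteq> carrier G"
  shows "admissible_group_topology G T (topology_generated_by {carrier G})"
proof -
  interpret group G by fact
  let ?X = "topology_generated_by {carrier G}"
  have top: "topspace ?X = carrier G" by simp
  have m: "(\<lambda>(x, y). x \<otimes>\<^bsub>G\<^esub> y) -` carrier G \<inter> topspace (prod_topology ?X ?X)
      = topspace (prod_topology ?X ?X)"
    by auto
  have i: "(\<lambda>x. inv\<^bsub>G\<^esub> x) -` carrier G \<inter> topspace ?X = topspace ?X"
    by auto
  have t: "(\<lambda>x. x) -` carrier G \<inter> topspace (T n) = topspace (T n)" for n
    using assms(2) by auto
  have "continuous_map (prod_topology ?X ?X) ?X (\<lambda>(x, y). x \<otimes>\<^bsub>G\<^esub> y)"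
    by (rule continuous_on_generated_topo) (simp only: singleton_iff m openin_topspace, auto)
  moreover have "continuous_map ?X ?X (\<lambda>x. inv\<^bsub>G\<^esub> x)"
    by (rule continuous_on_generated_topo) (simp only: singleton_iff i openin_topspace, auto)
  moreover have "continuous_map (T n) ?X (\<lambda>x. x)" for n
    by (rule continuous_on_generated_topo) (simp only: singleton_iff t openin_topspace, use assms(2) in auto)
  ultimately show ?thesis
    using assms(1) top by (simp add: admissible_group_topology_def topological_group_def)
qed

lemma strongest_admissible_unique:
  "strongest_admissible G T X \<Longrightarrow> strongest_admissible G T Y \<Longrightarrow> X = Y"
  by (auto simp: strongest_admissible_def topology_eq)

lemma strongest_admissible_ex:
  assumes "group G" "\<And>n. topspace (T n) \<subseteq> carrier G"
  shows "\<exists>X. strongest_admissible G T X"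
proof -
  let ?S = "{U. \<exists>Y. admissible_group_topology G T Y \<and> openin Y U}"
  let ?X = "topology_generated_by ?S"
  have top_adm: "topspace Y = carrier G" if "admissible_group_topology G T Y" for Y
    using that by (simp add: admissible_group_topology_def topological_group_def)
  have "\<Union>?S \<subseteq> carrier G"
    using top_adm openin_subset by blast
  moreover have "carrier G \<in> ?S"
  proof -
    have "openin (topology_generated_by {carrier G}) (carrier G)"
      by (rule topology_generated_by_Basis) simp
    then show ?thesis using admissible_indiscrete[of G T] assms by blast
  qed
  ultimately have US: "\<Union>?S = carrier G" by blast
  define X where "X = ?X"
  have topX: "topspace X = carrier G"
    using US by (simp add: X_def)
  have finer: "openin X U" if "admissible_group_topology G T Y" "openin Y U" for Y U
    unfolding X_def by (rule topology_generated_by_Basis) (use that in blast)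
  have into_X: "continuous_map Z X f"
    if "f ` topspace Z \<subseteq> carrier G"
      and Z: "\<And>Y. admissible_group_topology G T Y \<Longrightarrow> continuous_map Z Y f"
    for Z :: "'z topology" and f
    unfolding X_def
  proof (rule continuous_on_generated_topo)
    fix U assume "U \<in> ?S"
    then obtain Y where "admissible_group_topology G T Y" "openin Y U" by blast
    then show "openin Z (f -` U \<inter> topspace Z)"
      using Z[of Y] unfolding continuous_map_alt by blast
  next
    show "f ` topspace Z \<subseteq> \<Union>?S" using that(1) US by simp
  qed
  have id: "continuous_map X Y (\<lambda>x. x)" if Y: "admissible_group_topology G T Y" for Y
    unfolding continuous_map_def
  proof (intro conjI allI impI)
    show "(\<lambda>x. x) \<in> topspace X \<rightarrow> topspace Y"
      using topX top_adm[OF Y] by simp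
    fix U assume U: "openin Y U"
    then have "{x \<in> topspace X. x \<in> U} = U"
      using topX top_adm[OF Y] openin_subset by fastforce
    then show "openin X {x \<in> topspace X. x \<in> U}"
      using finer[OF Y U] by simp
  qed
  interpret group G by fact
  have mult: "continuous_map (prod_topology X X) X (\<lambda>(x, y). x \<otimes>\<^bsub>G\<^esub> y)"
  proof (rule into_X)
    show "(\<lambda>(x, y). x \<otimes>\<^bsub>G\<^esub> y) ` topspace (prod_topology X X) \<subseteq> carrier G"
      using topX by auto
    fix Y assume Y: "admissible_group_topology G T Y"
    have "continuous_map (prod_topology X X) (prod_topology Y Y) (\<lambda>z. (fst z, snd z))"
      using continuous_map_compose[OF continuous_map_fst id[OF Y], of X]
        continuous_map_compose[OF continuous_map_snd id[OF Y], of X]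
      by (intro continuous_map_pairedI) (simp_all add: o_def)
    moreover have "continuous_map (prod_topology Y Y) Y (\<lambda>(x, y). x \<otimes>\<^bsub>G\<^esub> y)"
      using Y by (simp add: admissible_group_topology_def topological_group_def)
    ultimately have "continuous_map (prod_topology X X) Y
        ((\<lambda>(x, y). x \<otimes>\<^bsub>G\<^esub> y) \<circ> (\<lambda>z. (fst z, snd z)))"
      by (rule continuous_map_compose)
    then show "continuous_map (prod_topology X X) Y (\<lambda>(x, y). x \<otimes>\<^bsub>G\<^esub> y)"
      by (simp add: o_def case_prod_unfold)
  qed
  have inv: "continuous_map X X (\<lambda>x. inv\<^bsub>G\<^esub> x)"
  proof (rule into_X)
    show "(\<lambda>x. inv\<^bsub>G\<^esub> x) ` topspace X \<subseteq> carrier G"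
      using topX by auto
    fix Y assume Y: "admissible_group_topology G T Y"
    then have "continuous_map Y Y (\<lambda>x. inv\<^bsub>G\<^esub> x)"
      by (simp add: admissible_group_topology_def topological_group_def)
    from continuous_map_compose[OF id[OF Y] this]
    show "continuous_map X Y (\<lambda>x. inv\<^bsub>G\<^esub> x)" by (simp add: o_def)
  qed
  have incl: "continuous_map (T n) X (\<lambda>x. x)" for n
    by (rule into_X) (use assms(2) in \<open>auto simp: admissible_group_topology_def\<close>)
  have "admissible_group_topology G T X"
    using mult inv incl topX assms(1)
    by (simp add: admissible_group_topology_def topological_group_def)
  with finer have "strongest_admissible G T X"
    by (auto simp: strongest_admissible_def)
  then show ?thesis by blast
qed

lemma strongest_admissible_g_lim:
  assumes "group_tower G H T"
  shows "strongest_admissible G T (g_lim G T)"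
proof -
  have "group G" using assms by (simp add: group_tower_def)
  moreover have "topspace (T n) \<subseteq> carrier G" for n
  proof -
    have "topological_group (G\<lparr>carrier := H n\<rparr>) (T n)" "carrier G = (\<Union>n. H n)"
      using assms unfolding group_tower_def by blast+
    then show ?thesis by (auto simp: topological_group_def)
  qed
  ultimately obtain X where X: "strongest_admissible G T X"
    using strongest_admissible_ex[of G T] by blast
  show ?thesis
    unfolding g_lim_def by (rule theI, rule X) (rule strongest_admissible_unique[OF _ X])
qed


section \<open>The four semitopological group topologies\<close>

text \<open>The finite products \<open>U\<^sub>0 U\<^sub>1 \<cdots> U\<^sub>m\<close> and \<open>U\<^sub>m \<cdots> U\<^sub>1 U\<^sub>0\<close>.\<close>

primrec right_prod_upto :: "('a, 'b) monoid_scheme \<Rightarrow> (nat \<Rightarrow> 'a set) \<Rightarrow> nat \<Rightarrow> 'a set" where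
  "right_prod_upto G U 0 = U 0"
| "right_prod_upto G U (Suc m) = right_prod_upto G U m <#>\<^bsub>G\<^esub> U (Suc m)"

primrec left_prod_upto :: "('a, 'b) monoid_scheme \<Rightarrow> (nat \<Rightarrow> 'a set) \<Rightarrow> nat \<Rightarrow> 'a set" where
  "left_prod_upto G U 0 = U 0"
| "left_prod_upto G U (Suc m) = U (Suc m) <#>\<^bsub>G\<^esub> left_prod_upto G U m"

definition right_prod :: "('a, 'b) monoid_scheme \<Rightarrow> (nat \<Rightarrow> 'a set) \<Rightarrow> 'a set" where
  "right_prod G U = (\<Union>m. right_prod_upto G U m)"

definition left_prod :: "('a, 'b) monoid_scheme \<Rightarrow> (nat \<Rightarrow> 'a set) \<Rightarrow> 'a set" where
  "left_prod G U = (\<Union>m. left_prod_upto G U m)"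

definition two_sided_prod :: "('a, 'b) monoid_scheme \<Rightarrow> (nat \<Rightarrow> 'a set) \<Rightarrow> 'a set" where
  "two_sided_prod G U = (\<Union>m. left_prod_upto G U m <#>\<^bsub>G\<^esub> right_prod_upto G U m)"

text \<open>
  In the following definitions \<open>\<B> n\<close> is the chosen neighborhood base at the neutral element of the
  \<open>n\<close>-th group. When each \<open>\<B> n\<close> is a \<open>symmetric_base_at_one\<close>, each generating family is a base of a
  topology on the group, so \<open>topology_generated_by\<close> yields exactly the topology with that base.
\<close>

definition right_topology :: "('a, 'b) monoid_scheme \<Rightarrow> (nat \<Rightarrow> 'a set set) \<Rightarrow> 'a topology" where
  "right_topology G \<B> = topology_generated_by
     {right_prod G U #>\<^bsub>G\<^esub> x | U x. (\<forall>n. U n \<in> \<B> n) \<and> x \<in> carrier G}"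

definition left_topology :: "('a, 'b) monoid_scheme \<Rightarrow> (nat \<Rightarrow> 'a set set) \<Rightarrow> 'a topology" where
  "left_topology G \<B> = topology_generated_by
     {x <#\<^bsub>G\<^esub> left_prod G U | U x. (\<forall>n. U n \<in> \<B> n) \<and> x \<in> carrier G}"

definition two_sided_topology ::
    "('a, 'b) monoid_scheme \<Rightarrow> (nat \<Rightarrow> 'a set set) \<Rightarrow> 'a topology" where
  "two_sided_topology G \<B> = topology_generated_by
     {(x <#\<^bsub>G\<^esub> two_sided_prod G U) #>\<^bsub>G\<^esub> y | U x y.
        (\<forall>n. U n \<in> \<B> n) \<and> x \<in> carrier G \<and> y \<in> carrier G}"

definition meet_topology :: "('a, 'b) monoid_scheme \<Rightarrow> (nat \<Rightarrow> 'a set set) \<Rightarrow> 'a topology" where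
  "meet_topology G \<B> = topology_generated_by
     {(x <#\<^bsub>G\<^esub> left_prod G U) \<inter> (right_prod G U #>\<^bsub>G\<^esub> y) | U x y.
        (\<forall>n. U n \<in> \<B> n) \<and> x \<in> carrier G \<and> y \<in> carrier G}"

end

theory Submission
  imports Defs
begin

text \<open>
  In an admissible group topology each neighborhood of \<open>\<one>\<close> contains right, left and two-sided products: take
  \<open>U\<^sub>n\<close> inside \<open>W\<^sub>n\<^sub>+\<^sub>1\<close>, where \<open>W\<^sub>n\<^sub>+\<^sub>1 W\<^sub>n\<^sub>+\<^sub>1 \<subseteq> W\<^sub>n\<close>. So it suffices that all the products are open
  in the direct limit. If \<open>y\<close> lies in a right or two-sided product \<open>Q\<close>, then already \<open>y V \<subseteq> Q\<close> for some
  right product \<open>V\<close>, hence it is enough that right products are neighborhoods of \<open>\<one>\<close>. For this one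
  verifies that they form a base at \<open>\<one>\<close> of some group topology. Given \<open>U\<close>, choose \<open>P\<^sub>n\<close> in the PTA base
  with \<open>P\<^sub>n P\<^sub>n \<subseteq> U\<^sub>n\<close> and then \<open>V\<^sub>n \<subseteq> P\<^sub>n\<close> with \<open>V\<^sub>n P\<^sub>0 \<cdots> P\<^sub>n\<^sub>-\<^sub>1 \<subseteq> P\<^sub>0 \<cdots> P\<^sub>n\<^sub>-\<^sub>1 P\<^sub>n\<close>. By induction
  \<open>V\<^sub>n \<cdots> V\<^sub>0 \<subseteq> P\<^sub>0 \<cdots> P\<^sub>n\<close>, which handles inversion, and \<open>(V\<^sub>0 \<cdots> V\<^sub>n)(P\<^sub>0 \<cdots> P\<^sub>n) \<subseteq> U\<^sub>0 \<cdots> U\<^sub>n\<close>, which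
  handles multiplication.
\<close>

section \<open>Topological groups\<close>

lemma set_mult_iff: "z \<in> A <#>\<^bsub>G\<^esub> B \<longleftrightarrow> (\<exists>a\<in>A. \<exists>b\<in>B. z = a \<otimes>\<^bsub>G\<^esub> b)"
  by (auto simp: set_mult_def)

lemma set_mult_subset_iff: "A <#>\<^bsub>G\<^esub> B \<subseteq> S \<longleftrightarrow> (\<forall>a\<in>A. \<forall>b\<in>B. a \<otimes>\<^bsub>G\<^esub> b \<in> S)"
  by (auto simp: set_mult_def)

lemma set_multI: "a \<in> A \<Longrightarrow> b \<in> B \<Longrightarrow> a \<otimes>\<^bsub>G\<^esub> b \<in> A <#>\<^bsub>G\<^esub> B"
  by (auto simp: set_mult_def)

lemma topological_group_mult_nbhds:
  assumes "topological_group G X" "openin X S" "x \<in> carrier G" "y \<in> carrier G" "x \<otimes>\<^bsub>G\<^esub> y \<in> S"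
  obtains A B where "openin X A" "openin X B" "x \<in> A" "y \<in> B" "A <#>\<^bsub>G\<^esub> B \<subseteq> S"
proof -
  let ?P = "{z \<in> topspace (prod_topology X X). (case z of (x, y) \<Rightarrow> x \<otimes>\<^bsub>G\<^esub> y) \<in> S}"
  have "openin (prod_topology X X) ?P"
    using assms(1,2) unfolding topological_group_def
    by (intro openin_continuous_map_preimage) auto
  moreover have "(x, y) \<in> ?P"
    using assms by (auto simp: topological_group_def)
  ultimately have "\<exists>A B. openin X A \<and> openin X B \<and> x \<in> A \<and> y \<in> B \<and> A \<times> B \<subseteq> ?P"
    by (simp only: openin_prod_topology_alt)
  then obtain A B where AB: "openin X A" "openin X B" "x \<in> A" "y \<in> B" "A \<times> B \<subseteq> ?P"
    by (elim exE conjE)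
  show ?thesis
    by (rule that[OF AB(1-4)]) (use AB(5) in \<open>auto simp: set_mult_subset_iff\<close>)
qed

lemma topological_group_square_nbhd:
  assumes "topological_group G X" "openin X S" "\<one>\<^bsub>G\<^esub> \<in> S"
  obtains A where "openin X A" "\<one>\<^bsub>G\<^esub> \<in> A" "A <#>\<^bsub>G\<^esub> A \<subseteq> S"
proof -
  interpret group G using assms(1) by (simp add: topological_group_def)
  obtain A B where AB: "openin X A" "openin X B" "\<one>\<^bsub>G\<^esub> \<in> A" "\<one>\<^bsub>G\<^esub> \<in> B" "A <#>\<^bsub>G\<^esub> B \<subseteq> S"
    by (rule topological_group_mult_nbhds[OF assms(1,2), of "\<one>\<^bsub>G\<^esub>" "\<one>\<^bsub>G\<^esub>"]) (use assms(3) in auto)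
  then show ?thesis
    by (intro that[of "A \<inter> B"]) (auto simp: set_mult_subset_iff)
qed

lemma topological_group_set_inv_open:
  assumes "topological_group G X" "openin X S"
  shows "openin X (set_inv\<^bsub>G\<^esub> S)"
proof -
  interpret group G using assms(1) by (simp add: topological_group_def)
  have "S \<subseteq> carrier G"
    using assms openin_subset by (auto simp: topological_group_def)
  then have "set_inv\<^bsub>G\<^esub> S = {x \<in> topspace X. inv\<^bsub>G\<^esub> x \<in> S}"
    using assms(1) by (force simp: SET_INV_def topological_group_def)
  moreover have "openin X \<dots>"
    using assms unfolding topological_group_def by (intro openin_continuous_map_preimage) auto
  ultimately show ?thesis by simp
qed

lemma topological_group_continuous_translations:
  assumes "topological_group G X" "a \<in> carrier G"
  shows "continuous_map X X (\<lambda>x. a \<otimes>\<^bsub>G\<^esub> x)" "continuous_map X X (\<lambda>x. x \<otimes>\<^bsub>G\<^esub> a)"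
proof -
  have m: "continuous_map (prod_topology X X) X (\<lambda>(x, y). x \<otimes>\<^bsub>G\<^esub> y)" and a: "a \<in> topspace X"
    using assms by (auto simp: topological_group_def)
  have "continuous_map X (prod_topology X X) (\<lambda>x. (a, x))"
    "continuous_map X (prod_topology X X) (\<lambda>x. (x, a))"
    using a by (auto intro!: continuous_map_pairedI)
  from this[THEN continuous_map_compose, OF m]
  show "continuous_map X X (\<lambda>x. a \<otimes>\<^bsub>G\<^esub> x)" "continuous_map X X (\<lambda>x. x \<otimes>\<^bsub>G\<^esub> a)"
    by (simp_all add: o_def)
qed

lemma topological_group_translations_open:
  assumes "topological_group G X" "openin X S" "a \<in> carrier G"
  shows "openin X (a <#\<^bsub>G\<^esub> S)" "openin X (S #>\<^bsub>G\<^esub> a)"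
proof -
  interpret group G using assms(1) by (simp add: topological_group_def)
  have top: "topspace X = carrier G" and S: "S \<subseteq> carrier G"
    using assms openin_subset by (auto simp: topological_group_def)
  have "a <#\<^bsub>G\<^esub> S = {x \<in> topspace X. inv\<^bsub>G\<^esub> a \<otimes>\<^bsub>G\<^esub> x \<in> S}"
    using S assms(3) by (force simp: l_coset_def top m_assoc[symmetric])
  moreover have "S #>\<^bsub>G\<^esub> a = {x \<in> topspace X. x \<otimes>\<^bsub>G\<^esub> inv\<^bsub>G\<^esub> a \<in> S}"
    using S assms(3) by (force simp: r_coset_def top m_assoc)
  ultimately show "openin X (a <#\<^bsub>G\<^esub> S)" "openin X (S #>\<^bsub>G\<^esub> a)"
    using topological_group_continuous_translations[OF assms(1), of "inv\<^bsub>G\<^esub> a"] assms(2,3)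
    by (auto intro!: openin_continuous_map_preimage)
qed

text \<open>A product with an arbitrary left factor is a union of left translates of
  \<open>S\<close>.\<close>

lemma topological_group_set_mult_open:
  assumes "topological_group G X" "openin X S" "A \<subseteq> carrier G"
  shows "openin X (A <#>\<^bsub>G\<^esub> S)"
proof -
  have "A <#>\<^bsub>G\<^esub> S = (\<Union>a\<in>A. a <#\<^bsub>G\<^esub> S)"
    by (auto simp: set_mult_def l_coset_def)
  then show ?thesis
    using topological_group_translations_open(1)[OF assms(1,2)] assms(3)
    by (auto intro!: openin_Union)
qed

section \<open>Group topologies from a base at the neutral element, and recognizing a generated
  topology\<close>

lemma (in group) inv_mult_cancel_left:
  assumes "x \<in> carrier G" "y \<in> carrier G"
  shows "inv x \<otimes> (x \<otimes> y) = y" "x \<otimes> (inv x \<otimes> y) = y"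
  using assms by (simp_all add: m_assoc[symmetric])

text \<open>The open sets are those that contain, with each \<open>x\<close>, some left translate of
  a member of \<open>N\<close>. Members of \<open>N\<close> may fail to be open and are only shown
  to be neighborhoods of \<open>\<one>\<close>. Invariance under conjugation is what lets left
  translates alone control multiplication and inversion.\<close>

lemma group_topology_of_base_at_one:
  fixes G (structure)
  assumes "group G" and ne: "N \<noteq> {}"
    and N: "\<And>P. P \<in> N \<Longrightarrow> P \<subseteq> carrier G" "\<And>P. P \<in> N \<Longrightarrow> \<one> \<in> P"
    and dir: "\<And>P Q. P \<in> N \<Longrightarrow> Q \<in> N \<Longrightarrow> \<exists>R\<in>N. R \<subseteq> P \<inter> Q"
    and mul: "\<And>P. P \<in> N \<Longrightarrow> \<exists>Q\<in>N. Q <#> Q \<subseteq> P"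
    and inv: "\<And>P. P \<in> N \<Longrightarrow> \<exists>Q\<in>N. set_inv Q \<subseteq> P"
    and conj: "\<And>P x. P \<in> N \<Longrightarrow> x \<in> carrier G \<Longrightarrow> \<exists>Q\<in>N. \<forall>q\<in>Q. x \<otimes> q \<otimes> inv x \<in> P"
  obtains X where "topological_group G X" "\<And>P. P \<in> N \<Longrightarrow> neighborhood X \<one> P"
    "\<And>S x. openin X S \<Longrightarrow> x \<in> S \<Longrightarrow> \<exists>P\<in>N. x <# P \<subseteq> S"
proof -
  interpret group G by fact
  let ?O = "\<lambda>S. S \<subseteq> carrier G \<and> (\<forall>x\<in>S. \<exists>P\<in>N. \<forall>p\<in>P. x \<otimes> p \<in> S)"
  define X where "X = topology ?O"
  have "istopology ?O"
    unfolding istopology_def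
  proof (intro conjI allI impI)
    fix S S' assume *: "?O S" "?O S'"
    then show "S \<inter> S' \<subseteq> carrier G" by auto
    show "\<forall>x\<in>S \<inter> S'. \<exists>P\<in>N. \<forall>p\<in>P. x \<otimes> p \<in> S \<inter> S'"
    proof
      fix x assume "x \<in> S \<inter> S'"
      then obtain P P' where "P \<in> N" "P' \<in> N" "\<forall>p\<in>P. x \<otimes> p \<in> S" "\<forall>p\<in>P'. x \<otimes> p \<in> S'"
        using * by blast
      moreover then obtain R where "R \<in> N" "R \<subseteq> P \<inter> P'" using dir by blast
      ultimately show "\<exists>P\<in>N. \<forall>p\<in>P. x \<otimes> p \<in> S \<inter> S'" by blast
    qed
  next
    fix K assume K: "\<forall>S\<in>K. ?O S"
    then show "\<Union>K \<subseteq> carrier G" by auto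
    show "\<forall>x\<in>\<Union>K. \<exists>P\<in>N. \<forall>p\<in>P. x \<otimes> p \<in> \<Union>K"
    proof
      fix x assume "x \<in> \<Union>K"
      then obtain S where S: "S \<in> K" "x \<in> S" by auto
      then obtain P where "P \<in> N" "\<forall>p\<in>P. x \<otimes> p \<in> S" using bspec[OF K S(1)] by auto
      then show "\<exists>P\<in>N. \<forall>p\<in>P. x \<otimes> p \<in> \<Union>K" using S(1) by auto
    qed
  qed
  then have op: "openin X S \<longleftrightarrow> ?O S" for S
    by (simp add: X_def topology_inverse')
  have "openin X (carrier G)" unfolding op using ne N by blast
  then have top: "topspace X = carrier G"
    using op by (metis openin_subset openin_topspace subset_antisym)
  have int: "\<exists>S. openin X S \<and> x \<in> S \<and> (\<forall>s\<in>S. \<exists>p\<in>P. s = x \<otimes> p)"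
    if x: "x \<in> carrier G" and P: "P \<in> N" for x P
  proof -
    \<comment> \<open>This is \<open>x\<close> times the interior of \<open>P\<close>. It is open
      because, when \<open>z Q\<close> lies in \<open>P\<close> and \<open>R R\<close> lies in
      \<open>Q\<close>, each point of \<open>z R\<close> again has a translate of \<open>R\<close>
      inside \<open>P\<close>.\<close>
    let ?S = "{x \<otimes> z | z. z \<in> carrier G \<and> (\<exists>Q\<in>N. \<forall>q\<in>Q. z \<otimes> q \<in> P)}"
    have "\<exists>R\<in>N. \<forall>r\<in>R. x \<otimes> z \<otimes> r \<in> ?S"
      if z: "z \<in> carrier G" and Q: "Q \<in> N" "\<forall>q\<in>Q. z \<otimes> q \<in> P" for z Q
    proof -
      obtain R where R: "R \<in> N" "R <#> R \<subseteq> Q" using mul Q(1) by blast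
      have "x \<otimes> z \<otimes> r \<in> ?S" if r: "r \<in> R" for r
      proof -
        have "z \<otimes> r \<otimes> q \<in> P" if "q \<in> R" for q
        proof -
          have "r \<otimes> q \<in> Q" using R r that by (auto simp: set_mult_subset_iff)
          then show ?thesis using Q z r that N(1)[OF R(1)] by (simp add: m_assoc subset_iff)
        qed
        moreover have "r \<in> carrier G" using r N(1)[OF R(1)] by auto
        ultimately show ?thesis using x z R(1)
          by (intro CollectI exI[of _ "z \<otimes> r"] conjI bexI[of _ R] ballI) (auto simp: m_assoc)
      qed
      then show ?thesis using R(1) by blast
    qed
    then have "openin X ?S" unfolding op using x by auto
    moreover have "x \<in> ?S"
      using x P N(1)[OF P] by (auto intro!: exI[of _ \<one>] bexI[of _ P])
    moreover have "z \<in> P" if "z \<in> carrier G" "Q \<in> N" "\<forall>q\<in>Q. z \<otimes> q \<in> P" for z Q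
      using that N(2) by force
    ultimately show ?thesis by blast
  qed
  have "continuous_map X X (\<lambda>x. inv x)"
    unfolding continuous_map_def
  proof (intro conjI allI impI)
    fix S assume S: "openin X S"
    have "\<exists>Q\<in>N. \<forall>q\<in>Q. inv (x \<otimes> q) \<in> S" if x: "x \<in> carrier G" "inv x \<in> S" for x
    proof -
      obtain P where P: "P \<in> N" "\<forall>p\<in>P. inv x \<otimes> p \<in> S" using S x unfolding op by blast
      \<comment> \<open>The inverse of \<open>x q\<close> equals \<open>inv x\<close> times the
        conjugate of \<open>inv q\<close> by \<open>x\<close>, so \<open>inv q\<close> has to be
        small after conjugation by \<open>x\<close>.\<close>
      obtain R where R: "R \<in> N" "\<forall>r\<in>R. x \<otimes> r \<otimes> inv x \<in> P" using conj P x by blast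
      obtain Q where Q: "Q \<in> N" "set_inv Q \<subseteq> R" using inv R by blast
      have "inv (x \<otimes> q) \<in> S" if q: "q \<in> Q" for q
      proof -
        have qc: "q \<in> carrier G" using q N(1)[OF Q(1)] by blast
        have "inv q \<in> R" using q Q by (auto simp: SET_INV_def)
        then have "inv x \<otimes> (x \<otimes> inv q \<otimes> inv x) \<in> S" using P R by blast
        then show ?thesis using x qc by (simp add: inv_mult_group m_assoc inv_mult_cancel_left)
      qed
      then show ?thesis using Q(1) by blast
    qed
    note * = this
    show "openin X {x \<in> topspace X. inv x \<in> S}"
      unfolding op top
    proof (intro conjI ballI)
      fix x assume x: "x \<in> {x \<in> carrier G. inv x \<in> S}"
      then obtain Q where Q: "Q \<in> N" "\<forall>q\<in>Q. inv (x \<otimes> q) \<in> S" using *[of x] by auto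
      then show "\<exists>P\<in>N. \<forall>p\<in>P. x \<otimes> p \<in> {x \<in> carrier G. inv x \<in> S}"
        using x N(1)[OF Q(1)] by (intro bexI[OF _ Q(1)]) auto
    qed auto
  qed (auto simp: top)
  moreover have "continuous_map (prod_topology X X) X (\<lambda>(x, y). x \<otimes> y)"
    unfolding continuous_map_def
  proof (intro conjI allI impI)
    fix S assume S: "openin X S"
    show "openin (prod_topology X X) {z \<in> topspace (prod_topology X X). (case z of (x, y) \<Rightarrow> x \<otimes> y) \<in> S}"
      unfolding openin_prod_topology_alt
    proof (intro allI impI)
      fix x y
      assume "(x, y) \<in> {z \<in> topspace (prod_topology X X). (case z of (x, y) \<Rightarrow> x \<otimes> y) \<in> S}"
      then have xy: "x \<in> carrier G" "y \<in> carrier G" "x \<otimes> y \<in> S" by (auto simp: top)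
      obtain P where P: "P \<in> N" "\<forall>p\<in>P. x \<otimes> y \<otimes> p \<in> S" using S xy unfolding op by blast
      obtain Q where Q: "Q \<in> N" "Q <#> Q \<subseteq> P" using mul P by blast
      \<comment> \<open>Since \<open>x r y q = x y (inv y r y) q\<close>, the perturbation
        \<open>r\<close> of the left argument is measured after conjugation by
        \<open>inv y\<close>.\<close>
      obtain R where R: "R \<in> N" "\<forall>r\<in>R. inv y \<otimes> r \<otimes> inv (inv y) \<in> Q"
        using conj[OF Q(1), of "inv y"] xy by blast
      obtain A where A: "openin X A" "x \<in> A" "\<forall>s\<in>A. \<exists>p\<in>R. s = x \<otimes> p"
        using int[OF xy(1) R(1)] by blast
      obtain B where B: "openin X B" "y \<in> B" "\<forall>s\<in>B. \<exists>p\<in>Q. s = y \<otimes> p"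
        using int[OF xy(2) Q(1)] by blast
      have "a \<otimes> b \<in> S" if ab: "a \<in> A" "b \<in> B" for a b
      proof -
        obtain r q where rq: "r \<in> R" "q \<in> Q" "a = x \<otimes> r" "b = y \<otimes> q" using A B ab by blast
        have c: "r \<in> carrier G" "q \<in> carrier G" using rq N(1) Q R by blast+
        have "inv y \<otimes> r \<otimes> y \<otimes> q \<in> P" using R rq xy Q by (auto simp: set_mult_subset_iff)
        then have "x \<otimes> y \<otimes> (inv y \<otimes> r \<otimes> y \<otimes> q) \<in> S" using P by blast
        moreover have "x \<otimes> y \<otimes> (inv y \<otimes> r \<otimes> y \<otimes> q) = a \<otimes> b"
          using xy c rq by (simp add: m_assoc inv_mult_cancel_left)
        ultimately show ?thesis by simp
      qed
      then show "\<exists>U V. openin X U \<and> openin X V \<and> x \<in> U \<and> y \<in> V \<and>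
          U \<times> V \<subseteq> {z \<in> topspace (prod_topology X X). (case z of (x, y) \<Rightarrow> x \<otimes> y) \<in> S}"
        using A(1,2) B(1,2) openin_subset[OF A(1)] openin_subset[OF B(1)]
        by (intro exI[of _ A] exI[of _ B]) auto
    qed
  qed (auto simp: top)
  ultimately have "topological_group G X"
    by (simp add: topological_group_def top is_group)
  moreover have "neighborhood X \<one> P" if P: "P \<in> N" for P
  proof -
    obtain S where S: "openin X S" "\<one> \<in> S" "\<forall>s\<in>S. \<exists>p\<in>P. s = \<one> \<otimes> p"
      using int[OF one_closed P] by auto
    have "S \<subseteq> P"
    proof
      fix s assume "s \<in> S"
      then obtain p where "p \<in> P" "s = \<one> \<otimes> p" using S(3) by auto
      then show "s \<in> P" using N(1)[OF P] by auto
    qed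
    then show ?thesis
      unfolding neighborhood_def top using S(1,2) N(1)[OF P] by auto
  qed
  moreover have "\<exists>P\<in>N. x <# P \<subseteq> S" if S: "openin X S" "x \<in> S" for S x
  proof -
    obtain P where "P \<in> N" "\<forall>p\<in>P. x \<otimes> p \<in> S" using S op by auto
    then show ?thesis by (intro bexI[of _ P]) (auto simp: l_coset_def)
  qed
  ultimately show ?thesis by (rule that)
qed

text \<open>Finite intersections of generators are open in \<open>X\<close> because the generators
  are, and each open set of \<open>X\<close> is a union of generators. As \<open>X\<close> is
  already at hand, no intersection property of \<open>K\<close> has to be checked.\<close>

lemma topology_generated_by_eqI:
  assumes "\<And>S. S \<in> K \<Longrightarrow> openin X S"
    and "\<And>S x. openin X S \<Longrightarrow> x \<in> S \<Longrightarrow> \<exists>B\<in>K. x \<in> B \<and> B \<subseteq> S"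
  shows "topology_generated_by K = X"
proof -
  have "openin X S" if "openin (topology_generated_by K) S" for S
  proof -
    have "generate_topology_on K S"
      using that by (simp add: openin_topology_generated_by_iff)
    then show ?thesis
      by induction (use assms(1) in auto)
  qed
  moreover have "openin (topology_generated_by K) S" if "openin X S" for S
    using assms(2)[OF that]
    by (subst openin_subopen) (meson topology_generated_by_Basis)
  ultimately show ?thesis
    by (auto simp: topology_eq)
qed

section \<open>Towers\<close>

text \<open>The bases are a parameter so that one tower can be equipped with two families of them:
  the one that defines the four topologies, and the one supplied by PTA in
  \<open>PTA_products\<close>.\<close>

locale based_tower = group G for G (structure) +
  fixes H :: "nat \<Rightarrow> 'a set" and T :: "nat \<Rightarrow> 'a topology" and \<B> :: "nat \<Rightarrow> 'a set set"
  assumes tower: "group_tower G H T"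
    and base: "symmetric_base_at_one G (T n) (\<B> n)"
begin

section \<open>Open sets and group operations in the groups of a tower\<close>

lemma subgroup_H: "subgroup (H n) G"
  using tower unfolding group_tower_def by blast

lemma topological_group_H: "topological_group (G\<lparr>carrier := H n\<rparr>) (T n)"
  using tower unfolding group_tower_def by blast

lemma topspace_T: "topspace (T n) = H n"
  using topological_group_H[of n] by (simp add: topological_group_def)

lemma carrier_eq: "carrier G = (\<Union>n. H n)"
  using tower unfolding group_tower_def by blast

lemma H_mono: "n \<le> m \<Longrightarrow> H n \<subseteq> H m"
proof (rule lift_Suc_mono_le[of H])
  show "H n \<subseteq> H (Suc n)" for n
    using tower unfolding group_tower_def by blast
qed

lemma one_H: "\<one> \<in> H n"
  using subgroup.one_closed[OF subgroup_H] .

lemma open_H: "openin (T n) (H n)"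
  using openin_topspace[of "T n"] by (simp add: topspace_T)

lemma T_subtopology: "n \<le> m \<Longrightarrow> T n = subtopology (T m) (H n)"
proof (induction m rule: dec_induct)
  case base
  show ?case by (metis subtopology_topspace topspace_T)
next
  case (step m)
  have "T m = subtopology (T (Suc m)) (H m)"
    using tower unfolding group_tower_def by blast
  then show ?case
    using step H_mono[OF step(1)] by (simp add: subtopology_subtopology inf_absorb2)
qed

lemma open_restrict: "openin (T m) S \<Longrightarrow> n \<le> m \<Longrightarrow> openin (T n) (S \<inter> H n)"
  using T_subtopology[of n m] by (auto simp: openin_subtopology)

text \<open>Set products and cosets refer to the multiplication only, which \<open>G\<close> shares
  with its restriction to \<open>H n\<close>. Facts about the topological group \<open>H n\<close>
  can therefore be read in \<open>G\<close>, here and in the next two lemmas.\<close>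

lemma square_nbhd:
  assumes "openin (T n) S" "\<one> \<in> S"
  obtains A where "openin (T n) A" "\<one> \<in> A" "A <#> A \<subseteq> S"
  using topological_group_square_nbhd[OF topological_group_H, of n S] assms
  by (auto simp: set_mult_def)

lemma translations_open:
  assumes "openin (T n) S" "a \<in> H n"
  shows "openin (T n) (a <# S)" "openin (T n) (S #> a)"
  using topological_group_translations_open[OF topological_group_H assms(1), of a] assms(2)
  by (simp_all add: l_coset_def r_coset_def)

lemma set_mult_open:
  assumes "openin (T n) S" "A \<subseteq> H n"
  shows "openin (T n) (A <#> S)"
  using topological_group_set_mult_open[OF topological_group_H assms(1), of A] assms(2)
  by (simp add: set_mult_def)

lemma base_in: "U \<in> \<B> n \<Longrightarrow> openin (T n) U" "U \<in> \<B> n \<Longrightarrow> \<one> \<in> U"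
  "U \<in> \<B> n \<Longrightarrow> set_inv U = U"
  using base[of n] by (auto simp: symmetric_base_at_one_def)

lemma base_subset: "U \<in> \<B> n \<Longrightarrow> U \<subseteq> H n"
  using base_in(1) openin_subset topspace_T by metis

lemma base_small:
  assumes "openin (T n) S" "\<one> \<in> S"
  obtains U where "U \<in> \<B> n" "U \<subseteq> S"
  using base[of n] assms unfolding symmetric_base_at_one_def neighbourhood_base_at_def by blast

section \<open>Sequences of basic neighborhoods and their products\<close>

definition base_seq :: "(nat \<Rightarrow> 'a set) \<Rightarrow> bool" where
  "base_seq U \<longleftrightarrow> (\<forall>n. U n \<in> \<B> n)"

lemma base_seq_choose:
  assumes "\<And>n. openin (T n) (S n)" "\<And>n. \<one> \<in> S n"
  obtains U where "base_seq U" "\<And>n. U n \<subseteq> S n"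
proof -
  have "\<exists>U. U \<in> \<B> n \<and> U \<subseteq> S n" for n
    by (meson assms base_small)
  then show ?thesis
    using that unfolding base_seq_def by metis
qed

lemma base_seq_one: "base_seq U \<Longrightarrow> \<one> \<in> U n"
  unfolding base_seq_def using base_in(2) by blast

lemma base_seq_inv: "base_seq U \<Longrightarrow> set_inv (U n) = U n"
  unfolding base_seq_def using base_in(3) by blast

lemma base_seq_subset: "base_seq U \<Longrightarrow> U n \<subseteq> H n"
  using base_subset by (simp add: base_seq_def)

lemma base_seq_open: "base_seq U \<Longrightarrow> openin (T n) (U n)"
  using base_in by (simp add: base_seq_def)

lemma H_carrier: "H n \<subseteq> carrier G"
  using carrier_eq by blast

lemma right_prod_upto_subset: "base_seq U \<Longrightarrow> right_prod_upto G U n \<subseteq> H n"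
proof (induction n)
  case (Suc n)
  then have "right_prod_upto G U n \<subseteq> H (Suc n)" "U (Suc n) \<subseteq> H (Suc n)"
    using H_mono[of n "Suc n"] base_seq_subset by auto
  then show ?case
    unfolding right_prod_upto.simps set_mult_subset_iff
    using subgroup.m_closed[OF subgroup_H[of "Suc n"]] by (meson subsetD)
qed (simp add: base_seq_subset)

lemma right_prod_upto_carrier: "base_seq U \<Longrightarrow> right_prod_upto G U n \<subseteq> carrier G"
  using right_prod_upto_subset H_carrier by blast

lemma right_prod_upto_open: "base_seq U \<Longrightarrow> openin (T n) (right_prod_upto G U n)"
proof (cases n)
  case (Suc k)
  assume "base_seq U"
  then show ?thesis
    unfolding Suc right_prod_upto.simps
    using right_prod_upto_subset[of U k] H_mono[of k "Suc k"]
    by (intro set_mult_open base_seq_open) auto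
qed (simp add: base_seq_open)

lemma right_prod_upto_mono:
  assumes "base_seq U" "n \<le> m"
  shows "right_prod_upto G U n \<subseteq> right_prod_upto G U m"
  using assms(2)
proof (induction m rule: dec_induct)
  case (step m)
  have "x \<in> right_prod_upto G U (Suc m)" if "x \<in> right_prod_upto G U m" for x
    using set_multI[OF that base_seq_one[OF assms(1), of "Suc m"], of G]
      right_prod_upto_carrier[OF assms(1), of m] that by auto
  then show ?case using step by blast
qed simp

lemma base_seq_le_right_prod_upto:
  assumes "base_seq U"
  shows "U n \<subseteq> right_prod_upto G U n"
proof (cases n)
  case (Suc k)
  have "\<one> \<in> right_prod_upto G U k"
    using right_prod_upto_mono[OF assms, of 0 k] base_seq_one[OF assms, of 0] by auto
  moreover have "U n \<subseteq> carrier G"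
    using base_seq_subset[OF assms] H_carrier by blast
  ultimately show ?thesis
    unfolding Suc using set_multI[of \<one> "right_prod_upto G U k" _ "U (Suc k)" G]
    by (auto simp: subset_iff)
qed simp

lemma one_right_prod_upto: "base_seq U \<Longrightarrow> \<one> \<in> right_prod_upto G U n"
  using base_seq_le_right_prod_upto base_seq_one by blast

lemma right_prod_upto_subset_mono:
  "(\<And>n. U n \<subseteq> V n) \<Longrightarrow> right_prod_upto G U n \<subseteq> right_prod_upto G V n"
  by (induction n) (simp_all add: mono_set_mult)

lemma right_prod_upto_cong:
  "(\<And>i. i \<le> n \<Longrightarrow> U i = V i) \<Longrightarrow> right_prod_upto G U n = right_prod_upto G V n"
  by (induction n) auto

text \<open>Inversion reverses the order of the factors and fixes each of them, as they are
  symmetric. Properties of left products thus follow from those of right products.\<close>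

lemma left_prod_upto_eq:
  assumes "base_seq U"
  shows "left_prod_upto G U n = set_inv (right_prod_upto G U n)"
proof (induction n)
  case 0
  then show ?case using base_seq_inv[OF assms] by simp
next
  case (Suc n)
  have U: "U (Suc n) \<subseteq> carrier G" "right_prod_upto G U n \<subseteq> carrier G"
    using base_seq_subset[OF assms] right_prod_upto_subset[OF assms] H_carrier by blast+
  have "set_inv (U (Suc n)) = U (Suc n)"
    using base_seq_inv[OF assms] by simp
  then have "left_prod_upto G U (Suc n) = set_inv (U (Suc n)) <#> set_inv (right_prod_upto G U n)"
    using Suc by simp
  also have "\<dots> = set_inv (right_prod_upto G U n <#> U (Suc n))"
    using U by (force simp: set_mult_iff SET_INV_def inv_mult_group subset_iff)
  finally show ?case by simp
qed

lemma left_prod_eq: "base_seq U \<Longrightarrow> left_prod G U = set_inv (right_prod G U)"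
  by (auto simp: left_prod_def right_prod_def left_prod_upto_eq SET_INV_def)

lemma left_prod_upto_subset: "base_seq U \<Longrightarrow> left_prod_upto G U n \<subseteq> H n"
  using right_prod_upto_subset subgroup.m_inv_closed[OF subgroup_H]
  by (fastforce simp: left_prod_upto_eq SET_INV_def)

lemma one_left_prod_upto: "base_seq U \<Longrightarrow> \<one> \<in> left_prod_upto G U n"
  using one_right_prod_upto by (force simp: left_prod_upto_eq SET_INV_def)

lemma right_prod_carrier: "base_seq U \<Longrightarrow> right_prod G U \<subseteq> carrier G"
  using right_prod_upto_carrier by (auto simp: right_prod_def)

lemma one_right_prod: "base_seq U \<Longrightarrow> \<one> \<in> right_prod G U"
  using one_right_prod_upto by (auto simp: right_prod_def)

text \<open>Finite products increase with the index, so the index may be raised above any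
  \<open>m\<close>. Inductions that start at \<open>m\<close> rather than at \<open>0\<close> rely
  on this.\<close>

lemma right_prodE:
  assumes "base_seq U" "x \<in> right_prod G U"
  obtains n where "m \<le> n" "x \<in> right_prod_upto G U n"
proof -
  obtain k where "x \<in> right_prod_upto G U k" using assms by (auto simp: right_prod_def)
  then have "x \<in> right_prod_upto G U (max m k)"
    using right_prod_upto_mono[OF assms(1), of k "max m k"] by auto
  then show ?thesis using that[of "max m k"] by simp
qed

section \<open>Small products, translates and conjugates\<close>

text \<open>With \<open>W' W'\<close> inside \<open>W\<close>, one copy of \<open>W'\<close>
  receives the shorter product and the other the last factor. All the neighborhoods live in the
  large group \<open>H m\<close> and are cut down to a smaller group only when a factor is
  chosen.\<close>

lemma finite_product_nbhd:
  assumes "openin (T m) W" "\<one> \<in> W" "k \<le> m"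
  shows "\<exists>V. base_seq V \<and> right_prod_upto G V k \<subseteq> W"
  using assms
proof (induction k arbitrary: W)
  case 0
  \<comment> \<open>Only the entry at \<open>0\<close> is constrained. This sequence fills the other
    entries arbitrarily.\<close>
  obtain V where V: "base_seq V"
    by (rule base_seq_choose[OF open_H one_H])
  obtain A where "A \<in> \<B> 0" "A \<subseteq> W \<inter> H 0"
    using base_small[OF open_restrict[OF 0(1), of 0]] 0 one_H by auto
  then show ?case
    using V by (intro exI[of _ "V(0 := A)"]) (auto simp: base_seq_def)
next
  case (Suc k)
  obtain W' where W': "openin (T m) W'" "\<one> \<in> W'" "W' <#> W' \<subseteq> W"
    using square_nbhd[OF Suc(2,3)] .
  obtain V where V: "base_seq V" "right_prod_upto G V k \<subseteq> W'"
    using Suc.IH[OF W'(1,2)] Suc.prems by auto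
  obtain A where A: "A \<in> \<B> (Suc k)" "A \<subseteq> W' \<inter> H (Suc k)"
    using base_small[OF open_restrict[OF W'(1) Suc(4)]] W'(2) one_H by auto
  have "right_prod_upto G (V(Suc k := A)) k = right_prod_upto G V k"
    by (rule right_prod_upto_cong) simp
  then have "right_prod_upto G (V(Suc k := A)) (Suc k) \<subseteq> W' <#> W'"
    using V A by (simp add: mono_set_mult)
  then have "right_prod_upto G (V(Suc k := A)) (Suc k) \<subseteq> W"
    using W'(3) by (rule order_trans)
  moreover have "base_seq (V(Suc k := A))"
    using V(1) A(1) by (simp add: base_seq_def)
  ultimately show ?case by blast
qed

text \<open>The factors up to index \<open>m\<close> are controlled through their product as a
  whole, the later ones individually. This suits an element of \<open>H m\<close>, whose
  translations and conjugations act on \<open>H i\<close> for \<open>i \<ge> m\<close>.\<close>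

lemma splice:
  assumes "openin (T m) W" "\<one> \<in> W"
    and "\<And>i. i > m \<Longrightarrow> openin (T i) (S i)" "\<And>i. i > m \<Longrightarrow> \<one> \<in> S i"
  obtains V where "base_seq V" "right_prod_upto G V m \<subseteq> W" "\<And>i. i > m \<Longrightarrow> V i \<subseteq> S i"
proof -
  obtain V where V: "base_seq V" "right_prod_upto G V m \<subseteq> W"
    using finite_product_nbhd[OF assms(1,2), of m] by auto
  \<comment> \<open>The value \<open>V i\<close> for \<open>i \<le> m\<close> is a placeholder that
    makes the choice total; these entries of \<open>V'\<close> are dropped in
    \<open>?V\<close>.\<close>
  obtain V' where V': "base_seq V'" "\<And>i. V' i \<subseteq> (if i > m then S i else V i)"
    by (rule base_seq_choose[of "\<lambda>i. if i > m then S i else V i"])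
      (use assms V base_seq_open base_seq_one in auto)
  let ?V = "\<lambda>i. if i > m then V' i else V i"
  have "right_prod_upto G ?V m = right_prod_upto G V m"
    by (rule right_prod_upto_cong) simp
  moreover have "?V i \<subseteq> S i" if "i > m" for i using V'(2)[of i] that by simp
  ultimately show ?thesis
    using V V' by (intro that[of ?V]) (auto simp: base_seq_def)
qed

text \<open>
  The cases of interest are \<open>A n = U\<^sub>0 \<cdots> U\<^sub>n\<close> and \<open>A n = U\<^sub>n \<cdots> U\<^sub>0 U\<^sub>0 \<cdots> U\<^sub>n\<close>.
\<close>

lemma increasing_union_translate:
  assumes U: "base_seq U" and A: "\<And>n. openin (T n) (A n)" "\<And>n. A n <#> U (Suc n) \<subseteq> A (Suc n)"
    and y: "y \<in> (\<Union>n. A n)"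
  obtains V where "base_seq V" "y <# right_prod G V \<subseteq> (\<Union>n. A n)"
proof -
  obtain m where m: "y \<in> A m" using y by blast
  have yH: "y \<in> H m" using m openin_subset[OF A(1)[of m]] by (auto simp: topspace_T)
  then have yc: "y \<in> carrier G" using H_carrier by blast
  \<comment> \<open>As \<open>y\<close> lies in the open set \<open>A m\<close>, the translate
    \<open>inv y <# A m\<close> has room for the initial product. The later factors are multiplied
    on from the right, and there the hypothesis on \<open>A\<close> keeps the result inside the
    union.\<close>
  obtain V where V: "base_seq V" "right_prod_upto G V m \<subseteq> inv y <# A m" "\<And>i. i > m \<Longrightarrow> V i \<subseteq> U i"
  proof (rule splice[of m "inv y <# A m" U])
    show "openin (T m) (inv y <# A m)"
      using translations_open(1)[OF A(1)] subgroup.m_inv_closed[OF subgroup_H yH] .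
    show "\<one> \<in> inv y <# A m" using m yc by (force simp: l_coset_def)
  qed (use U base_seq_open base_seq_one in auto)
  have *: "y \<otimes> v \<in> A n" if "m \<le> n" "v \<in> right_prod_upto G V n" for n v
    using that
  proof (induction n arbitrary: v rule: dec_induct)
    case base
    then obtain a where "a \<in> A m" "v = inv y \<otimes> a" using V(2) by (auto simp: l_coset_def)
    moreover then have "a \<in> carrier G"
      using openin_subset[OF A(1)[of m]] H_carrier[of m] by (auto simp: topspace_T)
    ultimately show ?case using yc by (simp add: inv_mult_cancel_left)
  next
    case (step n)
    then obtain a b where ab: "v = a \<otimes> b" "a \<in> right_prod_upto G V n" "b \<in> V (Suc n)"
      by (auto simp: set_mult_iff)
    have c: "a \<in> carrier G" "b \<in> carrier G"
      using ab right_prod_upto_carrier[OF V(1)] base_seq_subset[OF V(1)] H_carrier by blast+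
    have "y \<otimes> a \<in> A n" "b \<in> U (Suc n)" using step ab V(3)[of "Suc n"] by auto
    then have "(y \<otimes> a) \<otimes> b \<in> A (Suc n)" using A(2)[of n] by (auto simp: set_mult_subset_iff)
    then show ?case using ab c yc by (simp add: m_assoc)
  qed
  have "y \<otimes> v \<in> (\<Union>n. A n)" if v: "v \<in> right_prod G V" for v
  proof -
    obtain n where "m \<le> n" "v \<in> right_prod_upto G V n"
      using right_prodE[OF V(1) v] .
    then show ?thesis using *[of n v] by auto
  qed
  then show ?thesis using V(1) by (intro that[of V]) (auto simp: l_coset_def)
qed

text \<open>If \<open>x\<close> lies in \<open>H m\<close>, then each \<open>U i\<close> with
  \<open>i \<ge> m\<close> can be pulled back under conjugation by \<open>x\<close> within
  \<open>H i\<close>. Below \<open>m\<close> this is impossible factor by factor, so the whole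
  initial product of \<open>V\<close> is conjugated into the single factor
  \<open>U m\<close>.\<close>

lemma right_prod_conjugate:
  assumes U: "base_seq U" and x: "x \<in> carrier G"
  obtains V where "base_seq V" "\<And>v. v \<in> right_prod G V \<Longrightarrow> x \<otimes> v \<otimes> inv x \<in> right_prod G U"
proof -
  obtain m where m: "x \<in> H m" using x carrier_eq by blast
  define S where "S i = inv x <# (U i #> x)" for i
  have xi: "x \<in> H i" "inv x \<in> H i" if "m \<le> i" for i
    using m H_mono[OF that] subgroup.m_inv_closed[OF subgroup_H] by blast+
  have So: "openin (T i) (S i)" "\<one> \<in> S i" if "m \<le> i" for i
  proof -
    show "openin (T i) (S i)"
      unfolding S_def using xi[OF that] base_seq_open[OF U] by (intro translations_open)
    show "\<one> \<in> S i"
      unfolding S_def using x base_seq_one[OF U, of i] by (force simp: l_coset_def r_coset_def)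
  qed
  have conj: "x \<otimes> s \<otimes> inv x \<in> U i" if "s \<in> S i" for s i
  proof -
    obtain u where u: "u \<in> U i" "s = inv x \<otimes> (u \<otimes> x)"
      using \<open>s \<in> S i\<close> by (auto simp: S_def l_coset_def r_coset_def)
    then have "u \<in> carrier G" using base_seq_subset[OF U] H_carrier by blast
    then have "x \<otimes> s \<otimes> inv x = u" using u x by (simp add: m_assoc inv_mult_cancel_left)
    then show ?thesis using u by simp
  qed
  obtain V where V: "base_seq V" "right_prod_upto G V m \<subseteq> S m" "\<And>i. i > m \<Longrightarrow> V i \<subseteq> S i"
    by (rule splice[of m "S m" S]) (use So in auto)
  have *: "x \<otimes> v \<otimes> inv x \<in> right_prod_upto G U n" if "m \<le> n" "v \<in> right_prod_upto G V n" for n v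
    using that
  proof (induction n arbitrary: v rule: dec_induct)
    case base
    then show ?case using V(2) conj base_seq_le_right_prod_upto[OF U] by blast
  next
    case (step n)
    then obtain a b where ab: "v = a \<otimes> b" "a \<in> right_prod_upto G V n" "b \<in> V (Suc n)"
      by (auto simp: set_mult_iff)
    have c: "a \<in> carrier G" "b \<in> carrier G"
      using ab right_prod_upto_carrier[OF V(1)] base_seq_subset[OF V(1)] H_carrier by blast+
    have "x \<otimes> a \<otimes> inv x \<in> right_prod_upto G U n" "x \<otimes> b \<otimes> inv x \<in> U (Suc n)"
      using step ab V(3)[of "Suc n"] conj by auto
    moreover have "x \<otimes> v \<otimes> inv x = (x \<otimes> a \<otimes> inv x) \<otimes> (x \<otimes> b \<otimes> inv x)"
      using c x ab by (simp add: m_assoc inv_mult_cancel_left)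
    ultimately show ?case by (auto simp: set_mult_iff)
  qed
  have "x \<otimes> v \<otimes> inv x \<in> right_prod G U" if v: "v \<in> right_prod G V" for v
  proof -
    obtain n where "m \<le> n" "v \<in> right_prod_upto G V n"
      using right_prodE[OF V(1) v] .
    then show ?thesis using *[of n v] by (auto simp: right_prod_def)
  qed
  then show ?thesis using V(1) that by blast
qed

lemma right_prod_mono: "(\<And>n. U n \<subseteq> V n) \<Longrightarrow> right_prod G U \<subseteq> right_prod G V"
  unfolding right_prod_def by (intro UN_mono order_refl right_prod_upto_subset_mono)

section \<open>Products inside the neighborhoods of an admissible group topology\<close>

text \<open>One sequence serves all three products: right products are confined to a neighborhood
  \<open>B\<close> that is closed under inverses, hence so are left products, and \<open>B B\<close>
  lies in \<open>S\<close>.\<close>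

lemma admissible_topology_contains_products:
  assumes X: "admissible_group_topology G T X" and S: "openin X S" "\<one> \<in> S"
  obtains U where "base_seq U" "right_prod G U \<subseteq> S" "left_prod G U \<subseteq> S" "two_sided_prod G U \<subseteq> S"
proof -
  have tg: "topological_group G X" and incl: "continuous_map (T n) X (\<lambda>x. x)" for n
    using X by (auto simp: admissible_group_topology_def)
  obtain A where A: "openin X A" "\<one> \<in> A" "A <#> A \<subseteq> S"
    using topological_group_square_nbhd[OF tg S] .
  define B where "B = A \<inter> set_inv A"
  have "\<one> \<in> set_inv A"
    using A(2) by (force simp: SET_INV_def)
  then have B: "openin X B" "\<one> \<in> B"
    using A topological_group_set_inv_open[OF tg A(1)] by (auto simp: B_def)
  have Bc: "B \<subseteq> carrier G"
    using openin_subset[OF B(1)] tg by (simp add: topological_group_def)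
  have Ac: "A \<subseteq> carrier G"
    using openin_subset[OF A(1)] tg by (simp add: topological_group_def)
  have Binv: "inv b \<in> B" if "b \<in> B" for b
    using that Ac unfolding B_def SET_INV_def by auto
  have step: "\<exists>W'. (openin X W' \<and> \<one> \<in> W') \<and> W' <#> W' \<subseteq> W" if "openin X W" "\<one> \<in> W" for W
    using topological_group_square_nbhd[OF tg that] by metis
  \<comment> \<open>The clause for \<open>n = 0\<close> pins the start of the chain of successive
    square roots to \<open>B\<close>.\<close>
  have "\<exists>W. \<forall>n. ((openin X (W n) \<and> \<one> \<in> W n) \<and> (n = 0 \<longrightarrow> W n = B)) \<and>
      W (Suc n) <#> W (Suc n) \<subseteq> W n"
  proof (rule dependent_nat_choice)
    show "\<exists>W. (openin X W \<and> \<one> \<in> W) \<and> ((0::nat) = 0 \<longrightarrow> W = B)"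
      using B by simp
    show "\<exists>W'. ((openin X W' \<and> \<one> \<in> W') \<and> (Suc n = 0 \<longrightarrow> W' = B)) \<and> W' <#> W' \<subseteq> W"
      if "(openin X W \<and> \<one> \<in> W) \<and> (n = 0 \<longrightarrow> W = B)" for W n
      using step[of W] that by simp
  qed
  then obtain W where "\<forall>n. ((openin X (W n) \<and> \<one> \<in> W n) \<and> (n = 0 \<longrightarrow> W n = B)) \<and>
      W (Suc n) <#> W (Suc n) \<subseteq> W n" ..
  then have W: "W 0 = B" "\<And>n. openin X (W n)" "\<And>n. \<one> \<in> W n"
      "\<And>n. W (Suc n) <#> W (Suc n) \<subseteq> W n"
    by simp_all
  have Wc: "W n \<subseteq> carrier G" for n
    using openin_subset[OF W(2)[of n]] tg by (simp add: topological_group_def)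
  obtain U where U: "base_seq U" "\<And>n. U n \<subseteq> {x \<in> topspace (T n). x \<in> W (Suc n)}"
  proof (rule base_seq_choose[of "\<lambda>n. {x \<in> topspace (T n). x \<in> W (Suc n)}"])
    show "openin (T n) {x \<in> topspace (T n). x \<in> W (Suc n)}" for n
      by (rule openin_continuous_map_preimage[OF incl W(2)])
    show "\<one> \<in> {x \<in> topspace (T n). x \<in> W (Suc n)}" for n
      using W(3) one_H by (simp add: topspace_T)
  qed (rule that)
  \<comment> \<open>The spare factor \<open>W (Suc n)\<close> strengthens the induction: it has room
    for the next factor \<open>U (Suc n)\<close> together with the next spare factor. Hence the
    shift by one in the choice of \<open>U\<close>.\<close>
  have R: "right_prod_upto G U n <#> W (Suc n) \<subseteq> B" for n
  proof (induction n)
    case 0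
    have "U 0 <#> W (Suc 0) \<subseteq> W (Suc 0) <#> W (Suc 0)"
      by (rule mono_set_mult) (use U(2)[of 0] in auto)
    then show ?case using W(4)[of 0] by (auto simp: W(1))
  next
    case (Suc n)
    have "right_prod_upto G U (Suc n) <#> W (Suc (Suc n))
        = right_prod_upto G U n <#> (U (Suc n) <#> W (Suc (Suc n)))"
      using right_prod_upto_carrier[OF U(1), of n] base_seq_subset[OF U(1), of "Suc n"]
        H_carrier[of "Suc n"] Wc by (simp add: set_mult_assoc)
    also have "\<dots> \<subseteq> right_prod_upto G U n <#> (W (Suc (Suc n)) <#> W (Suc (Suc n)))"
      by (intro mono_set_mult) (use U(2)[of "Suc n"] in auto)
    also have "\<dots> \<subseteq> right_prod_upto G U n <#> W (Suc n)"
      by (intro mono_set_mult W(4) order_refl)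
    finally show ?case using Suc by simp
  qed
  have r: "right_prod_upto G U n \<subseteq> B" for n
  proof
    fix x assume x: "x \<in> right_prod_upto G U n"
    then have "x \<otimes> \<one> \<in> B" using R[of n] W(3)[of "Suc n"] by (auto simp: set_mult_subset_iff)
    then show "x \<in> B" using x right_prod_upto_carrier[OF U(1), of n] by auto
  qed
  have l: "left_prod_upto G U n \<subseteq> B" for n
    using r[of n] Binv by (auto simp: left_prod_upto_eq[OF U(1)] SET_INV_def)
  have BB: "B <#> B \<subseteq> S"
    using A(3) by (auto simp: B_def set_mult_subset_iff)
  have "B \<subseteq> S"
  proof
    fix b assume b: "b \<in> B"
    then have "b \<otimes> \<one> \<in> S" using BB B(2) by (auto simp: set_mult_subset_iff)
    then show "b \<in> S" using b Bc by auto
  qed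
  then have "right_prod G U \<subseteq> S" "left_prod G U \<subseteq> S"
    using r l unfolding right_prod_def left_prod_def by blast+
  moreover have "left_prod_upto G U n <#> right_prod_upto G U n \<subseteq> S" for n
    using mono_set_mult[OF l[of n] r[of n], of G] BB by (rule order_trans)
  then have "two_sided_prod G U \<subseteq> S"
    unfolding two_sided_prod_def by blast
  ultimately show ?thesis using U(1) that by blast
qed

section \<open>Consequences of PTA for products\<close>

text \<open>A neighborhood is moved past the factors one at a time. All neighborhoods are taken in
  \<open>H k\<close>, whose index bounds those of all the factors, so that \<open>pass\<close>
  applies to each factor.\<close>

lemma passing_finite_product:
  assumes U: "base_seq U"
    and pass: "\<And>n m V. n \<le> m \<Longrightarrow> neighborhood (T m) \<one> V \<Longrightarrow>
      \<exists>W. neighborhood (T m) \<one> W \<and> W <#> U n \<subseteq> U n <#> V"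
    and "j \<le> k" "neighborhood (T k) \<one> Z"
  shows "\<exists>W. neighborhood (T k) \<one> W \<and> W <#> right_prod_upto G U j \<subseteq> right_prod_upto G U j <#> Z"
  using assms(3,4)
proof (induction j arbitrary: Z)
  case 0
  then show ?case using pass[of 0 k Z] by simp
next
  case (Suc j)
  have c: "V \<subseteq> carrier G" if "neighborhood (T k) \<one> V" for V
    using that H_carrier[of k] by (auto simp: neighborhood_def topspace_T)
  let ?R = "right_prod_upto G U j" and ?U = "U (Suc j)"
  have Rc: "?R \<subseteq> carrier G" "?U \<subseteq> carrier G"
    using right_prod_upto_carrier[OF U, of j] base_seq_subset[OF U, of "Suc j"] H_carrier[of "Suc j"]
    by auto
  \<comment> \<open>The choice runs backwards: \<open>Z\<close> determines what may pass the last
    factor, and the resulting \<open>W1\<close> is the target for the shorter product.\<close>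
  obtain W1 where W1: "neighborhood (T k) \<one> W1" "W1 <#> ?U \<subseteq> ?U <#> Z"
    using pass[of "Suc j" k Z] Suc.prems by auto
  obtain W where W: "neighborhood (T k) \<one> W" "W <#> ?R \<subseteq> ?R <#> W1"
    using Suc.IH[OF _ W1(1)] Suc.prems by auto
  have "W <#> (?R <#> ?U) = (W <#> ?R) <#> ?U"
    using Rc c[OF W(1)] by (simp add: set_mult_assoc)
  also have "\<dots> \<subseteq> (?R <#> W1) <#> ?U"
    by (intro mono_set_mult W order_refl)
  also have "\<dots> = ?R <#> (W1 <#> ?U)"
    using Rc c[OF W1(1)] by (simp add: set_mult_assoc)
  also have "\<dots> \<subseteq> ?R <#> (?U <#> Z)"
    by (intro mono_set_mult W1 order_refl)
  also have "\<dots> = (?R <#> ?U) <#> Z"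
    using Rc c[OF Suc.prems(2)] by (simp add: set_mult_assoc)
  finally show ?case using W(1) by auto
qed

text \<open>PTA speaks of its own bases, whereas \<open>U\<close> and \<open>V\<close> come from
  \<open>\<B>\<close>. So the factors \<open>P n\<close> that get passed are taken from the PTA
  bases inside \<open>U n\<close>, and \<open>V n\<close> from \<open>\<B> n\<close> inside
  \<open>P n\<close>.\<close>

lemma PTA_products:
  assumes pta: "PTA G T" and U: "base_seq U"
  obtains V where "base_seq V" "right_prod G V <#> right_prod G V \<subseteq> right_prod G U"
    "left_prod G V \<subseteq> right_prod G U"
proof -
  have "\<forall>n. \<exists>B. symmetric_base_at_one G (T n) B \<and>
      (\<forall>U\<in>B. \<forall>m\<ge>n. \<forall>V. neighborhood (T m) \<one> V \<longrightarrow>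
        (\<exists>W. neighborhood (T m) \<one> W \<and> W <#> U \<subseteq> U <#> V))"
    using pta unfolding PTA_def .
  then obtain C where C: "\<forall>n. symmetric_base_at_one G (T n) (C n) \<and>
      (\<forall>U\<in>C n. \<forall>m\<ge>n. \<forall>V. neighborhood (T m) \<one> V \<longrightarrow>
        (\<exists>W. neighborhood (T m) \<one> W \<and> W <#> U \<subseteq> U <#> V))"
    by (elim choice[THEN exE])
  interpret C: based_tower G H T C
    using C tower by unfold_locales auto
  have "\<exists>S. openin (T n) S \<and> \<one> \<in> S \<and> S <#> S \<subseteq> U n" for n
    using square_nbhd[OF base_seq_open[OF U] base_seq_one[OF U], of n] by metis
  then obtain S where S: "\<And>n. openin (T n) (S n)" "\<And>n. \<one> \<in> S n" "\<And>n. S n <#> S n \<subseteq> U n"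
    by metis
  obtain P where P: "C.base_seq P" "\<And>n. P n \<subseteq> S n \<inter> U n"
    by (rule C.base_seq_choose[of "\<lambda>n. S n \<inter> U n"])
      (use S base_seq_open[OF U] base_seq_one[OF U] in auto)
  have PP: "P n <#> P n \<subseteq> U n" for n
    using mono_set_mult[of "P n" "S n" "P n" "S n" G] P(2)[of n] S(3)[of n] by auto
  let ?R = "right_prod_upto G P"
  have pass: "\<exists>W. neighborhood (T m) \<one> W \<and> W <#> P n \<subseteq> P n <#> V"
    if "n \<le> m" "neighborhood (T m) \<one> V" for n m V
  proof -
    have "P n \<in> C n" using P(1) unfolding C.base_seq_def by blast
    then show ?thesis using C that by blast
  qed
  \<comment> \<open>At \<open>n = 0\<close> there is nothing to pass. At \<open>n = Suc k\<close>
    the set \<open>W\<close> passes the first factors up to \<open>P k\<close>, and what emerges on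
    the right is absorbed by the new factor \<open>P n\<close>.\<close>
  have "\<exists>W. openin (T n) W \<and> \<one> \<in> W \<and> (\<forall>k. n = Suc k \<longrightarrow> W <#> ?R k \<subseteq> ?R n)" for n
  proof (cases n)
    case 0
    then show ?thesis using open_H[of n] one_H[of n] by auto
  next
    case (Suc k)
    have "neighborhood (T n) \<one> (P n)"
      using C.base_seq_open[OF P(1), of n] C.base_seq_one[OF P(1), of n] openin_subset
      unfolding neighborhood_def by blast
    then obtain W where W: "neighborhood (T n) \<one> W" "W <#> ?R k \<subseteq> ?R k <#> P n"
      using C.passing_finite_product[OF P(1) pass, of k n "P n"] Suc by auto
    then obtain W' where W': "openin (T n) W'" "\<one> \<in> W'" "W' \<subseteq> W"
      unfolding neighborhood_def by blast
    have "W' <#> ?R k \<subseteq> ?R n"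
      using mono_set_mult[OF W'(3) order_refl, of G "?R k"] W(2) Suc by auto
    then show ?thesis using W' Suc by auto
  qed
  then obtain W where W: "\<And>n. openin (T n) (W n)" "\<And>n. \<one> \<in> W n"
      "\<And>n. W (Suc n) <#> ?R n \<subseteq> ?R (Suc n)"
    by metis
  obtain V where V: "base_seq V" "\<And>n. V n \<subseteq> W n \<inter> P n"
    by (rule base_seq_choose[of "\<lambda>n. W n \<inter> P n"])
      (use W C.base_seq_open[OF P(1)] C.base_seq_one[OF P(1)] in auto)
  have VR: "V (Suc n) <#> ?R n \<subseteq> ?R (Suc n)" for n
    using mono_set_mult[of "V (Suc n)" "W (Suc n)" "?R n" "?R n" G] V(2)[of "Suc n"] W(3)[of n] by auto
  have PU: "?R n \<subseteq> right_prod_upto G U n" for n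
    by (rule right_prod_upto_subset_mono) (use P(2) in auto)
  have VP: "right_prod_upto G V n \<subseteq> ?R n" for n
    by (rule right_prod_upto_subset_mono) (use V(2) in auto)
  have left: "left_prod_upto G V n \<subseteq> ?R n" for n
  proof (induction n)
    case 0
    then show ?case using V(2)[of 0] by simp
  next
    case (Suc n)
    then show ?case
      using mono_set_mult[OF order_refl Suc, of G "V (Suc n)"] order_trans[OF _ VR[of n]] by simp
  qed
  \<comment> \<open>The right-hand product is built from \<open>P\<close>, past which the factors of
    \<open>V\<close> can move. In the induction step \<open>?v\<close> passes \<open>?R n\<close>
    and emerges inside \<open>?p\<close>; the two copies of \<open>?p\<close> then multiply into
    \<open>U (Suc n)\<close>.\<close>
  have sq: "right_prod_upto G V n <#> ?R n \<subseteq> right_prod_upto G U n" for n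
  proof (induction n)
    case 0
    then show ?case using mono_set_mult[of "V 0" "P 0" "P 0" "P 0" G] V(2)[of 0] PP[of 0] by simp
  next
    case (Suc n)
    let ?V = "right_prod_upto G V n" and ?v = "V (Suc n)" and ?p = "P (Suc n)"
    have c: "?V \<subseteq> carrier G" "?R n \<subseteq> carrier G" "?v \<subseteq> carrier G" "?p \<subseteq> carrier G"
      using right_prod_upto_carrier[OF V(1)] C.right_prod_upto_carrier[OF P(1)]
        base_seq_subset[OF V(1)] C.base_seq_subset[OF P(1)] H_carrier by blast+
    have "(?V <#> ?v) <#> (?R n <#> ?p) = ?V <#> ((?v <#> ?R n) <#> ?p)"
      using c by (simp add: set_mult_assoc set_mult_closed)
    also have "\<dots> \<subseteq> ?V <#> ((?R n <#> ?p) <#> ?p)"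
      by (rule mono_set_mult[OF order_refl mono_set_mult[OF _ order_refl]]) (use VR[of n] in simp)
    also have "\<dots> = (?V <#> ?R n) <#> (?p <#> ?p)"
      using c by (simp add: set_mult_assoc set_mult_closed)
    also have "\<dots> \<subseteq> right_prod_upto G U n <#> U (Suc n)"
      by (intro mono_set_mult Suc PP)
    finally show ?case by simp
  qed
  have "right_prod G V <#> right_prod G V \<subseteq> right_prod G U"
    unfolding set_mult_subset_iff
  proof (intro ballI)
    fix x y assume "x \<in> right_prod G V" and y: "y \<in> right_prod G V"
    then obtain m where m: "x \<in> right_prod_upto G V m" by (auto simp: right_prod_def)
    obtain n where n: "m \<le> n" "y \<in> right_prod_upto G V n"
      using right_prodE[OF V(1) y, of m] .
    have "x \<in> right_prod_upto G V n" "y \<in> ?R n"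
      using m n right_prod_upto_mono[OF V(1) n(1)] VP by blast+
    then have "x \<otimes> y \<in> right_prod_upto G U n" using sq[of n] by (auto simp: set_mult_subset_iff)
    then show "x \<otimes> y \<in> right_prod G U" by (auto simp: right_prod_def)
  qed
  moreover have "left_prod G V \<subseteq> right_prod G U"
    using left PU unfolding left_prod_def right_prod_def by blast
  ultimately show ?thesis using V(1) that by blast
qed

section \<open>Openness of the products in the direct limit\<close>

text \<open>The right products form a base at \<open>\<one>\<close> of a group topology
  \<open>X\<close> that makes the inclusions continuous. The direct limit topology is the strongest
  such topology, so neighborhoods in \<open>X\<close> remain neighborhoods in it.\<close>

lemma right_prod_nbhd_g_lim:
  assumes pta: "PTA G T" and U: "base_seq U"
  shows "neighborhood (g_lim G T) \<one> (right_prod G U)"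
proof -
  let ?N = "{right_prod G U | U. base_seq U}"
  obtain X where X: "topological_group G X" "\<And>P. P \<in> ?N \<Longrightarrow> neighborhood X \<one> P"
    "\<And>S x. openin X S \<Longrightarrow> x \<in> S \<Longrightarrow> \<exists>P\<in>?N. x <# P \<subseteq> S"
  proof (rule group_topology_of_base_at_one[of G ?N])
    show "group G" by (rule is_group)
    show "?N \<noteq> {}" using U by auto
    fix P assume "P \<in> ?N"
    then obtain V where V: "base_seq V" and P: "P = right_prod G V" by auto
    show "P \<subseteq> carrier G" "\<one> \<in> P"
      using right_prod_carrier[OF V] one_right_prod[OF V] P by auto
    obtain V' where V': "base_seq V'" "right_prod G V' <#> right_prod G V' \<subseteq> P"
        "left_prod G V' \<subseteq> P"
      using PTA_products[OF pta V] P by metis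
    show "\<exists>Q\<in>?N. Q <#> Q \<subseteq> P" using V' by blast
    \<comment> \<open>The inverse of a right product is the left product of the same sequence, which
      \<open>V'\<close> keeps inside \<open>P\<close>.\<close>
    show "\<exists>Q\<in>?N. set_inv Q \<subseteq> P"
      using V'(3) left_prod_eq[OF V'(1)] V'(1) by (intro bexI[of _ "right_prod G V'"]) auto
    show "\<exists>Q\<in>?N. \<forall>q\<in>Q. x \<otimes> q \<otimes> inv x \<in> P" if x: "x \<in> carrier G" for x
    proof -
      obtain V'' where "base_seq V''" "\<And>v. v \<in> right_prod G V'' \<Longrightarrow> x \<otimes> v \<otimes> inv x \<in> P"
        using right_prod_conjugate[OF V x] P by metis
      then show ?thesis by (intro bexI[of _ "right_prod G V''"]) auto
    qed
    fix Q assume "Q \<in> ?N"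
    then obtain W where W: "base_seq W" and Q: "Q = right_prod G W" by auto
    obtain Z where Z: "base_seq Z" "\<And>n. Z n \<subseteq> V n \<inter> W n"
      by (rule base_seq_choose[of "\<lambda>n. V n \<inter> W n"])
        (use V W base_seq_open base_seq_one in auto)
    have "right_prod G Z \<subseteq> P \<inter> Q"
      using right_prod_mono[of Z V] right_prod_mono[of Z W] Z(2) unfolding P Q by blast
    then show "\<exists>R\<in>?N. R \<subseteq> P \<inter> Q" using Z(1) by blast
  qed (rule that)
  have "continuous_map (T n) X (\<lambda>x. x)" for n
    unfolding continuous_map_def
  proof (intro conjI allI impI)
    show "(\<lambda>x. x) \<in> topspace (T n) \<rightarrow> topspace X"
      using H_carrier[of n] X(1) by (auto simp: topspace_T topological_group_def)
    fix S assume S: "openin X S"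
    show "openin (T n) {x \<in> topspace (T n). x \<in> S}"
    proof (subst openin_subopen, intro ballI)
      fix x assume "x \<in> {x \<in> topspace (T n). x \<in> S}"
      then have x: "x \<in> H n" "x \<in> S" by (auto simp: topspace_T)
      then obtain V where V: "base_seq V" "x <# right_prod G V \<subseteq> S" using X(3)[OF S, of x] by auto
      \<comment> \<open>The single factor \<open>V n\<close> is open in \<open>H n\<close>, so its
        translate by \<open>x\<close> is the required neighborhood in that group.\<close>
      have "V n \<subseteq> right_prod G V"
        using base_seq_le_right_prod_upto[OF V(1), of n] by (auto simp: right_prod_def)
      then have "x <# V n \<subseteq> S" using V(2) by (auto simp: l_coset_def)
      moreover have o: "openin (T n) (x <# V n)"
        by (rule translations_open(1)[OF base_seq_open[OF V(1)] x(1)])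
      moreover have "x \<in> x <# V n"
        using x(1) H_carrier[of n] base_seq_one[OF V(1), of n] by (force simp: l_coset_def)
      ultimately show "\<exists>S'. openin (T n) S' \<and> x \<in> S' \<and> S' \<subseteq> {x \<in> topspace (T n). x \<in> S}"
        using openin_subset[OF o] by (intro exI[of _ "x <# V n"]) auto
    qed
  qed
  then have "admissible_group_topology G T X"
    using X(1) by (simp add: admissible_group_topology_def)
  then have "openin (g_lim G T) S" if "openin X S" for S
    using that strongest_admissible_g_lim[OF tower] unfolding strongest_admissible_def by blast
  moreover have "neighborhood X \<one> (right_prod G U)"
    using X(2) U by auto
  ultimately show ?thesis
    unfolding neighborhood_def by (metis openin_subset openin_topspace order_trans)
qed

lemma admissible_g_lim: "admissible_group_topology G T (g_lim G T)"
  using strongest_admissible_g_lim[OF tower] unfolding strongest_admissible_def by blast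

lemma topological_group_g_lim: "topological_group G (g_lim G T)"
  using admissible_g_lim unfolding admissible_group_topology_def by blast

lemma increasing_union_open_g_lim:
  assumes "PTA G T" "base_seq U" "\<And>n. openin (T n) (A n)" "\<And>n. A n <#> U (Suc n) \<subseteq> A (Suc n)"
  shows "openin (g_lim G T) (\<Union>n. A n)"
proof (subst openin_subopen, intro ballI)
  fix y assume y: "y \<in> (\<Union>n. A n)"
  obtain V where V: "base_seq V" "y <# right_prod G V \<subseteq> (\<Union>n. A n)"
    using increasing_union_translate[OF assms(2-4) y] .
  obtain S where S: "openin (g_lim G T) S" "\<one> \<in> S" "S \<subseteq> right_prod G V"
    using right_prod_nbhd_g_lim[OF assms(1) V(1)] unfolding neighborhood_def by blast
  have "A n \<subseteq> carrier G" for n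
    using openin_subset[OF assms(3)[of n]] H_carrier[of n] by (simp add: topspace_T)
  then have yc: "y \<in> carrier G"
    using y by auto
  have "openin (g_lim G T) (y <# S)"
    by (rule topological_group_translations_open(1)[OF topological_group_g_lim S(1) yc])
  moreover have "y \<in> y <# S" using S(2) yc by (force simp: l_coset_def)
  moreover have "y <# S \<subseteq> (\<Union>n. A n)" using S(3) V(2) by (auto simp: l_coset_def)
  ultimately show "\<exists>S'. openin (g_lim G T) S' \<and> y \<in> S' \<and> S' \<subseteq> (\<Union>n. A n)" by blast
qed

text \<open>Right and two-sided products grow by \<open>U (Suc n)\<close> at the right end, as
  \<open>increasing_union_open_g_lim\<close> demands. Left products grow at the other end and are
  handled as inverses of right products.\<close>

lemma products_open_g_lim:
  assumes pta: "PTA G T" and U: "base_seq U"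
  shows "openin (g_lim G T) (right_prod G U)" "openin (g_lim G T) (left_prod G U)"
    "openin (g_lim G T) (two_sided_prod G U)"
proof -
  show r: "openin (g_lim G T) (right_prod G U)"
    unfolding right_prod_def
    by (rule increasing_union_open_g_lim[OF pta U]) (simp_all add: right_prod_upto_open[OF U])
  show "openin (g_lim G T) (left_prod G U)"
    unfolding left_prod_eq[OF U]
    by (rule topological_group_set_inv_open[OF topological_group_g_lim r])
  show "openin (g_lim G T) (two_sided_prod G U)"
    unfolding two_sided_prod_def
  proof (rule increasing_union_open_g_lim[OF pta U])
    fix n
    let ?L = "left_prod_upto G U n" and ?R = "right_prod_upto G U n" and ?U = "U (Suc n)"
    show "openin (T n) (?L <#> ?R)"
      by (rule set_mult_open[OF right_prod_upto_open[OF U] left_prod_upto_subset[OF U]])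
    have c: "?L \<subseteq> carrier G" "?R \<subseteq> carrier G" "?U \<subseteq> carrier G"
      using left_prod_upto_subset[OF U] right_prod_upto_carrier[OF U] base_seq_subset[OF U] H_carrier
      by blast+
    \<comment> \<open>A two-sided product also gains a factor on the left; it contains
      \<open>\<one>\<close>, so it can be inserted.\<close>
    have "x \<in> ?U <#> ?L" if "x \<in> ?L" for x
      using set_multI[OF base_seq_one[OF U, of "Suc n"] that, of G] c(1) that by auto
    then have "?L \<subseteq> ?U <#> ?L" by blast
    then have "?L <#> (?R <#> ?U) \<subseteq> (?U <#> ?L) <#> (?R <#> ?U)"
      by (intro mono_set_mult order_refl)
    then show "?L <#> ?R <#> ?U \<subseteq> left_prod_upto G U (Suc n) <#> right_prod_upto G U (Suc n)"
      using c by (simp add: set_mult_assoc)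
  qed
qed

lemma one_products:
  assumes "base_seq U"
  shows "\<one> \<in> left_prod G U" "\<one> \<in> two_sided_prod G U"
proof -
  show "\<one> \<in> left_prod G U"
    using one_left_prod_upto[OF assms] by (auto simp: left_prod_def)
  have "\<one> \<otimes> \<one> \<in> two_sided_prod G U"
    unfolding two_sided_prod_def
    by (rule UN_I[OF UNIV_I]) (rule set_multI[OF one_left_prod_upto[OF assms] one_right_prod_upto[OF assms]])
  then show "\<one> \<in> two_sided_prod G U" by simp
qed

section \<open>Identification of the four topologies with the direct limit\<close>

text \<open>\<open>S\<close> is moved back to \<open>\<one>\<close> by a left and by a right
  translation. A sequence whose products fit into the intersection of both works for either
  side.\<close>

lemma contains_translated_products:
  assumes S: "openin (g_lim G T) S" and x: "x \<in> S"
  obtains U where "base_seq U" "right_prod G U #> x \<subseteq> S" "x <# left_prod G U \<subseteq> S"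
    "x <# two_sided_prod G U \<subseteq> S"
proof -
  note tg = topological_group_g_lim
  have Sc: "S \<subseteq> carrier G"
    using openin_subset[OF S] tg by (simp add: topological_group_def)
  then have xc: "x \<in> carrier G" using x by blast
  let ?S = "(S #> inv x) \<inter> (inv x <# S)"
  have "openin (g_lim G T) ?S"
    using topological_group_translations_open[OF tg S, of "inv x"] xc by (intro openin_Int) auto
  moreover have "\<one> \<in> ?S"
    using x xc by (force simp: l_coset_def r_coset_def)
  ultimately obtain U where U: "base_seq U" "right_prod G U \<subseteq> ?S" "left_prod G U \<subseteq> ?S"
      "two_sided_prod G U \<subseteq> ?S"
    using admissible_topology_contains_products[OF admissible_g_lim] by metis
  have r: "z \<otimes> x \<in> S" if z: "z \<in> S #> inv x" for z
  proof -
    obtain s where "s \<in> S" "z = s \<otimes> inv x" using z by (auto simp: r_coset_def)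
    then show ?thesis using Sc xc by (auto simp: m_assoc subset_iff)
  qed
  have l: "x \<otimes> z \<in> S" if z: "z \<in> inv x <# S" for z
  proof -
    obtain s where "s \<in> S" "z = inv x \<otimes> s" using z by (auto simp: l_coset_def)
    then show ?thesis using Sc xc by (auto simp: inv_mult_cancel_left subset_iff)
  qed
  have "A #> x \<subseteq> S" "x <# A \<subseteq> S" if A: "A \<subseteq> ?S" for A
  proof -
    have "a \<otimes> x \<in> S" "x \<otimes> a \<in> S" if "a \<in> A" for a
      using r[of a] l[of a] A that by auto
    then show "A #> x \<subseteq> S" "x <# A \<subseteq> S"
      by (auto simp: r_coset_def l_coset_def)
  qed
  from this(1)[OF U(2)] this(2)[OF U(3)] this(2)[OF U(4)]
  have "right_prod G U #> x \<subseteq> S" "x <# left_prod G U \<subseteq> S" "x <# two_sided_prod G U \<subseteq> S" .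
  then show ?thesis using U(1) that by blast
qed

lemma topologies_eq_g_lim:
  assumes pta: "PTA G T"
  shows "right_topology G \<B> = g_lim G T" "left_topology G \<B> = g_lim G T"
    "meet_topology G \<B> = g_lim G T" "two_sided_topology G \<B> = g_lim G T"
proof -
  note tg = topological_group_g_lim
  note trans = topological_group_translations_open[OF tg]
  note op = products_open_g_lim[OF pta]
  have c: "x \<in> carrier G" if "openin (g_lim G T) S" "x \<in> S" for S x
    using openin_subset[OF that(1)] that(2) tg by (auto simp: topological_group_def)
  have rc: "x \<in> A #> x" and lc: "x \<in> x <# A" if "\<one> \<in> A" "x \<in> carrier G" for x A
    using that by (force simp: r_coset_def l_coset_def)+
  show "right_topology G \<B> = g_lim G T"
    unfolding right_topology_def base_seq_def[symmetric]
  proof (rule topology_generated_by_eqI)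
    fix S x assume S: "openin (g_lim G T) S" "x \<in> S"
    obtain U where U: "base_seq U" "right_prod G U #> x \<subseteq> S"
      using contains_translated_products[OF S] .
    have "x \<in> right_prod G U #> x" by (rule rc[OF one_right_prod[OF U(1)] c[OF S]])
    then show "\<exists>B\<in>{right_prod G U #> x |U x. base_seq U \<and> x \<in> carrier G}. x \<in> B \<and> B \<subseteq> S"
      using U c[OF S] by (intro bexI[of _ "right_prod G U #> x"]) auto
  qed (use op trans in auto)
  show "left_topology G \<B> = g_lim G T"
    unfolding left_topology_def base_seq_def[symmetric]
  proof (rule topology_generated_by_eqI)
    fix S x assume S: "openin (g_lim G T) S" "x \<in> S"
    obtain U where U: "base_seq U" "x <# left_prod G U \<subseteq> S"
      using contains_translated_products[OF S] .
    have "x \<in> x <# left_prod G U" by (rule lc[OF one_products(1)[OF U(1)] c[OF S]])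
    then show "\<exists>B\<in>{x <# left_prod G U |U x. base_seq U \<and> x \<in> carrier G}. x \<in> B \<and> B \<subseteq> S"
      using U c[OF S] by (intro bexI[of _ "x <# left_prod G U"]) auto
  qed (use op trans in auto)
  show "meet_topology G \<B> = g_lim G T"
    unfolding meet_topology_def base_seq_def[symmetric]
  proof (rule topology_generated_by_eqI)
    fix S x assume S: "openin (g_lim G T) S" "x \<in> S"
    obtain U where U: "base_seq U" "x <# left_prod G U \<subseteq> S"
      using contains_translated_products[OF S] .
    \<comment> \<open>Both translations are by \<open>x\<close>, so that \<open>x\<close> lies in
      both parts; the left part already keeps the intersection inside \<open>S\<close>.\<close>
    let ?B = "(x <# left_prod G U) \<inter> (right_prod G U #> x)"
    have "x \<in> ?B"
      using lc[OF one_products(1)[OF U(1)] c[OF S]] rc[OF one_right_prod[OF U(1)] c[OF S]] by simp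
    moreover have "?B \<in> {(x <# left_prod G U) \<inter> (right_prod G U #> y) |U x y.
        base_seq U \<and> x \<in> carrier G \<and> y \<in> carrier G}"
      using U(1) c[OF S] by blast
    ultimately show "\<exists>B\<in>{(x <# left_prod G U) \<inter> (right_prod G U #> y) |U x y.
        base_seq U \<and> x \<in> carrier G \<and> y \<in> carrier G}. x \<in> B \<and> B \<subseteq> S"
      using U(2) by (intro bexI[of _ ?B]) auto
  qed (use op trans in \<open>auto intro!: openin_Int\<close>)
  show "two_sided_topology G \<B> = g_lim G T"
    unfolding two_sided_topology_def base_seq_def[symmetric]
  proof (rule topology_generated_by_eqI)
    fix S x assume S: "openin (g_lim G T) S" "x \<in> S"
    obtain U where U: "base_seq U" "x <# two_sided_prod G U \<subseteq> S"
      using contains_translated_products[OF S] .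
    have "two_sided_prod G U \<subseteq> carrier G"
      using openin_subset[OF op(3)[OF U(1)]] tg by (simp add: topological_group_def)
    \<comment> \<open>Generators of this topology carry a right translation as well, which is taken
      to be by \<open>\<one>\<close>.\<close>
    then have eq: "(x <# two_sided_prod G U) #> \<one> = x <# two_sided_prod G U"
      using c[OF S] by (intro coset_mult_one l_coset_subset_G)
    have "x \<in> x <# two_sided_prod G U" by (rule lc[OF one_products(2)[OF U(1)] c[OF S]])
    moreover have "x <# two_sided_prod G U \<in> {x <# two_sided_prod G U #> y |U x y.
        base_seq U \<and> x \<in> carrier G \<and> y \<in> carrier G}"
      using U(1) c[OF S] eq[symmetric] one_closed by blast
    ultimately show "\<exists>B\<in>{x <# two_sided_prod G U #> y |U x y.
        base_seq U \<and> x \<in> carrier G \<and> y \<in> carrier G}. x \<in> B \<and> B \<subseteq> S"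
      using U(2) by (intro bexI[of _ "x <# two_sided_prod G U"]) auto
  qed (use op trans in auto)
qed

end

theorem theorem3p2:
  fixes G :: "('a, 'b) monoid_scheme"
    and H :: "nat \<Rightarrow> 'a set"
    and T :: "nat \<Rightarrow> 'a topology"
    and \<B> :: "nat \<Rightarrow> 'a set set"
  assumes "group_tower G H T"
    and "PTA G T"
    and "\<And>n. symmetric_base_at_one G (T n) (\<B> n)"
  shows "topological_group G (right_topology G \<B>) \<and>
    topological_group G (left_topology G \<B>) \<and>
    topological_group G (meet_topology G \<B>) \<and>
    topological_group G (two_sided_topology G \<B>) \<and>
    continuous_map (two_sided_topology G \<B>) (meet_topology G \<B>) (\<lambda>x. x) \<and>
    homeomorphic_map (meet_topology G \<B>) (g_lim G T) (\<lambda>x. x) \<and>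
    homeomorphic_map (two_sided_topology G \<B>) (g_lim G T) (\<lambda>x. x) \<and>
    g_lim G T = right_topology G \<B> \<and>
    g_lim G T = left_topology G \<B> \<and>
    g_lim G T = meet_topology G \<B> \<and>
    g_lim G T = two_sided_topology G \<B>"
proof -
  have "group G"
    using assms(1) unfolding group_tower_def by blast
  then interpret based_tower G H T \<B>
    using assms(1,3) by (simp add: based_tower_def based_tower_axioms_def)
  \<comment> \<open>After rewriting all four topologies to the direct limit, the continuity and
    homeomorphism claims concern the identity of a single space.\<close>
  show ?thesis
    using topological_group_g_lim homeomorphic_map_id[of "g_lim G T" "g_lim G T"]
    by (simp add: topologies_eq_g_lim[OF assms(2)] id_def)
qed

end
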